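(* If $V\in\{0,1\}^{\mathbb{N}}$ is a Sturmian sequence, then $(X_V,\sigma)$ is a spacer rank-two subshift (spacer rank-two system).
   Context: A Sturmian sequence is an element $V\in\{0,1\}^{\mathbb{N}}$ such that for every $n$ the number of words of length $n$ that are subwords of $V$ is $n+1$. For an infinite word $V$, $X_V=\{x\in\{0,1\}^{\mathbb{Z}}:\text{every finite subword of }x\text{ is a subword of }V\}$, with the shift $\sigma(x)(i)=x(i+1)$. Building: $\mathbb{N}$ is the set of nonnegative integers; $\mathcal{F}$ is the set of all finite binary words that start and end with $0$; $1^a$ is $a$ consecutive $1$s. For finite $S\subset\mathcal{F}$, a finite word $w$ is built from $S$ if $w=v_11^{a_1}v_21^{a_2}\cdots v_k1^{a_k}v_{k+1}$ for some $k\ge 1$, $v_i\in S$, $a_i\in\mathbb{N}$; it is built from $S$ starting with $u$ if moreover one can take $v_1=u$. An infinite word $V$ has an at most spacer rank-$n$ construction if there are finite sets $S_i=\{v_{i,1},\dots,v_{i,n_i}\}\subset\mathcal{F}$ ($i\in\mathbb{N}$) with $1\le n_i\le n$ such that: $v_{0,j}=0$ for all $j$; $v_{i+1,1}$ is built from $S_i$ starting with $v_{i,1}$; $v_{i+1,j}$ is built from $S_i$ for all $2\le j\le n_{i+1}$; and $v_{i,1}$ is an initial segment of $V$ for all $i$. A rank-one (spacer rank-one) construction is an at most spacer rank-$1$ construction; $V$ has a spacer rank-two construction if it has an at most spacer rank-$2$ construction but no at most spacer rank-$1$ construction. A subshift $X$ is a spacer rank-two system if there is a word $W$ with a spacer rank-two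 construction such that $X=X_W$, and there is no word $W'$ with a rank-one construction such that $X=X_{W'}$. *)

theory Defs
  imports "HOL-Analysis.Function_Topology"
begin

text \<open>
  The alphabet is \<^typ>\<open>bool\<close>, with \<^term>\<open>False\<close> for the letter 0 and \<^term>\<open>True\<close> for the letter 1;
  it carries the discrete topology, and function types carry the product topology.
\<close>

text \<open>Used with index type \<^typ>\<open>nat\<close> for infinite words and \<^typ>\<open>int\<close> for bi-infinite words.\<close>

definition subword :: "bool list \<Rightarrow> ('i::semiring_1 \<Rightarrow> bool) \<Rightarrow> bool" where
  "subword u x \<longleftrightarrow> (\<exists>m. u = map (\<lambda>j. x (m + of_nat j)) [0..<length u])"

definition initial_segment :: "bool list \<Rightarrow> (nat \<Rightarrow> bool) \<Rightarrow> bool" where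
  "initial_segment u V \<longleftrightarrow> u = map V [0..<length u]"

definition sturmian :: "(nat \<Rightarrow> bool) \<Rightarrow> bool" where
  "sturmian V \<longleftrightarrow> (\<forall>n. card {u. length u = n \<and> subword u V} = n + 1)"

definition shift :: "(int \<Rightarrow> bool) \<Rightarrow> (int \<Rightarrow> bool)" where
  "shift x = (\<lambda>i. x (i + 1))"

definition subshift :: "(int \<Rightarrow> bool) set \<Rightarrow> bool" where
  "subshift X \<longleftrightarrow> closed X \<and> shift ` X = X"

definition subshift_of :: "(nat \<Rightarrow> bool) \<Rightarrow> (int \<Rightarrow> bool) set" where
  "subshift_of V = {x. \<forall>u. subword u x \<longrightarrow> subword u V}"

definition zero_bounded_words :: "bool list set" where
  "zero_bounded_words = {w. w \<noteq> [] \<and> hd w = False \<and> last w = False}"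

text \<open>The word \<open>v\<^sub>1 1\<^bsup>a\<^sub>1\<^esup> v\<^sub>2 1\<^bsup>a\<^sub>2\<^esup> \<dots> v\<^sub>k 1\<^bsup>a\<^sub>k\<^esup> v\<^bsub>k+1\<^esub>\<close>.\<close>

definition spaced_word :: "nat \<Rightarrow> (nat \<Rightarrow> bool list) \<Rightarrow> (nat \<Rightarrow> nat) \<Rightarrow> bool list" where
  "spaced_word k v a = concat (map (\<lambda>i. v i @ replicate (a i) True) [1..<k + 1]) @ v (k + 1)"

definition built_from :: "bool list set \<Rightarrow> bool list \<Rightarrow> bool" where
  "built_from S w \<longleftrightarrow>
    (\<exists>k v a. k \<ge> 1 \<and> (\<forall>i\<in>{1..k + 1}. v i \<in> S) \<and> w = spaced_word k v a)"

definition built_from_starting_with :: "bool list set \<Rightarrow> bool list \<Rightarrow> bool list \<Rightarrow> bool" where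
  "built_from_starting_with S u w \<longleftrightarrow>
    (\<exists>k v a. k \<ge> 1 \<and> (\<forall>i\<in>{1..k + 1}. v i \<in> S) \<and> v 1 = u \<and> w = spaced_word k v a)"

text \<open>
  The set \<open>S\<^sub>i\<close> is \<^term>\<open>v i ` {1..N i}\<close>; the enumeration need not be injective, and the values
  \<^term>\<open>v i j\<close> for \<^term>\<open>j \<notin> {1..N i}\<close> play no role.
\<close>

definition at_most_spacer_rank_construction :: "nat \<Rightarrow> (nat \<Rightarrow> bool) \<Rightarrow> bool" where
  "at_most_spacer_rank_construction n V \<longleftrightarrow>
    (\<exists>(N :: nat \<Rightarrow> nat) (v :: nat \<Rightarrow> nat \<Rightarrow> bool list).
      (\<forall>i. 1 \<le> N i \<and> N i \<le> n) \<and>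
      (\<forall>i. v i ` {1..N i} \<subseteq> zero_bounded_words) \<and>
      (\<forall>j\<in>{1..N 0}. v 0 j = [False]) \<and>
      (\<forall>i. built_from_starting_with (v i ` {1..N i}) (v i 1) (v (i + 1) 1)) \<and>
      (\<forall>i. \<forall>j\<in>{2..N (i + 1)}. built_from (v i ` {1..N i}) (v (i + 1) j)) \<and>
      (\<forall>i. initial_segment (v i 1) V))"

definition spacer_rank_one_construction :: "(nat \<Rightarrow> bool) \<Rightarrow> bool" where
  "spacer_rank_one_construction V \<longleftrightarrow> at_most_spacer_rank_construction 1 V"

definition spacer_rank_two_construction :: "(nat \<Rightarrow> bool) \<Rightarrow> bool" where
  "spacer_rank_two_construction V \<longleftrightarrow>
    at_most_spacer_rank_construction 2 V \<and> \<not> at_most_spacer_rank_construction 1 V"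

definition spacer_rank_two_system :: "(int \<Rightarrow> bool) set \<Rightarrow> bool" where
  "spacer_rank_two_system X \<longleftrightarrow>
    subshift X \<and>
    (\<exists>W. spacer_rank_two_construction W \<and> X = subshift_of W) \<and>
    \<not> (\<exists>W'. spacer_rank_one_construction W' \<and> X = subshift_of W')"

end

theory Submission
  imports Defs "HOL-Library.Sublist" "HOL-Library.Infinite_Set"
begin

text \<open>
  A word of complexity \<open>n + 1\<close> is recurrent and has exactly one right special factor of each
  length. Reading it as \<open>0 1\<^bsup>s 0\<^esup> 0 1\<^bsup>s 1\<^esup> \<dots>\<close>, right special factors of the gap word \<open>s\<close> decode to
  right special factors of the original word, so \<open>s\<close> again has complexity \<open>n + 1\<close>, over two
  consecutive values.

  A rank-one construction would make \<open>s\<close> equal to \<open>C x\<^sub>1 C x\<^sub>2 C \<dots>\<close> for arbitrarily long prefixes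
  \<open>C\<close> of \<open>s\<close>; counting rotations of \<open>C x\<close> shows that \<open>C\<close>, hence \<open>s\<close>, is constant.

  Conversely, recode \<open>s\<close> so that its isolated letter becomes the new 0 and iterate. This writes
  the language through pairs \<open>(X, Y)\<close> with \<open>X' = X Y\<^bsup>c\<^esup>\<close>, \<open>Y' = X Y\<^bsup>d\<^esup>\<close>, \<open>|c - d| = 1\<close>, and the limit of the
  words \<open>X\<close> is generated by the two words obtained by deleting trailing ones from \<open>X\<close> and \<open>Y\<close>.
  The limit has the same factors as the original word because it has right special factors of
  every length, hence complexity at least \<open>n + 1\<close>.
\<close>

section \<open>Complexity, recurrence and right special factors\<close>

text \<open>Version of \<open>subword\<close> over an arbitrary alphabet, since gap words have
  letters in \<open>nat\<close>.\<close>

definition factor :: "'a list \<Rightarrow> (nat \<Rightarrow> 'a) \<Rightarrow> bool" where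
  "factor u f \<longleftrightarrow> (\<exists>i. u = map f [i..<i + length u])"

definition factors :: "(nat \<Rightarrow> 'a) \<Rightarrow> nat \<Rightarrow> 'a list set" where
  "factors f n = {u. length u = n \<and> factor u f}"

definition minimal_complexity :: "(nat \<Rightarrow> 'a) \<Rightarrow> bool" where
  "minimal_complexity f \<longleftrightarrow> (\<forall>n. card (factors f n) = n + 1)"

definition eventually_periodic :: "(nat \<Rightarrow> 'a) \<Rightarrow> bool" where
  "eventually_periodic f \<longleftrightarrow> (\<exists>N p. p > 0 \<and> (\<forall>m\<ge>N. f (m + p) = f m))"

lemma map_upt_add: "map f [i..<i + n] = map (\<lambda>j. f (i + j)) [0..<n]"
  by (rule nth_equalityI) auto

lemma subword_iff_factor: "subword u V \<longleftrightarrow> factor u V"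
  by (simp add: subword_def factor_def map_upt_add)

lemma factor_map_upt [simp]: "factor (map f [i..<j]) f"
proof (cases "i \<le> j")
  case True
  then show ?thesis unfolding factor_def by (intro exI[of _ i]) simp
qed (simp add: factor_def)

lemma factor_sublist:
  assumes "factor w f" "sublist u w"
  shows "factor u f"
proof -
  obtain i where "w = map f [i..<i + length w]"
    using assms(1) factor_def by blast
  moreover obtain p q where "w = p @ u @ q"
    using assms(2) by (auto simp: sublist_def)
  ultimately have *: "(p @ u @ q) ! j = f (i + j)" if "j < length w" for j
    using that by (metis add.commute diff_add_inverse length_map length_upt nth_map nth_upt add_less_cancel_left)
  have "u ! j = f (i + length p + j)" if "j < length u" for j
    using *[of "length p + j"] that \<open>w = p @ u @ q\<close>
    by (simp add: nth_append add.assoc)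
  then have "u = map f [i + length p..<i + length p + length u]"
    by (intro nth_equalityI) auto
  then show ?thesis
    unfolding factor_def by blast
qed

lemma factors_eq_range: "factors f n = range (\<lambda>i. map f [i..<i + n])"
  by (force simp: factors_def factor_def)

lemma factors_0: "factors f 0 = {[]}"
  by (auto simp: factors_eq_range)

lemma butlast_factors: "butlast ` factors f (Suc n) = factors f n"
  by (simp add: factors_eq_range image_image)

lemma map_tail_upt: "map (\<lambda>i. f (t + i)) [i..<i + n] = map f [t + i..<t + i + n]"
  by (rule nth_equalityI) (auto simp: add.assoc)

lemma factor_tail: "factor u (\<lambda>i. f (t + i)) \<Longrightarrow> factor u f"
  unfolding factor_def map_tail_upt by blast

text \<open>An infinite set has \<open>card\<close> 0, so the value \<open>n + 1\<close> already
  forces finiteness.\<close>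

lemma minimal_complexity_finite: "minimal_complexity f \<Longrightarrow> finite (factors f n)"
  by (metis add_gr_0 card_gt_0_iff minimal_complexity_def zero_less_one)

text \<open>Morse and Hedlund: once two consecutive complexities agree, every letter is
  determined by the window preceding it, and a repeated window forces a period.\<close>

lemma eventually_periodic_if_low_complexity:
  assumes fin: "\<And>n. finite (factors f n)" and n: "card (factors f n) \<le> n"
  shows "eventually_periodic f"
proof -
  \<comment> \<open>Otherwise the complexity would start at 1 and grow strictly, exceeding
    \<open>n\<close> at length \<open>n\<close>.\<close>
  have "\<exists>k. card (factors f (Suc k)) \<le> card (factors f k)"
  proof (rule ccontr)
    assume "\<not> ?thesis"
    then have "card (factors f k) < card (factors f (Suc k))" for k
      by (meson not_le)
    then have "card (factors f k) \<ge> k + 1" for k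
      by (induction k) (auto simp: factors_0 Suc_le_eq intro: le_less_trans)
    then show False
      using n by (metis Suc_eq_plus1 not_less_eq_eq)
  qed
  then obtain k where k: "card (factors f (Suc k)) \<le> card (factors f k)" ..
  \<comment> \<open>Truncation maps the factors of length \<open>Suc k\<close> onto those of length
    \<open>k\<close>; without growth it is injective, so right extensions are unique.\<close>
  have inj: "inj_on butlast (factors f (Suc k))"
    using k fin butlast_factors[of f k] card_image_le[OF fin, of butlast "Suc k"]
    by (intro eq_card_imp_inj_on) auto
  have step: "f (m + k) = f (m' + k)" if "map f [m..<m + k] = map f [m'..<m' + k]" for m m'
  proof -
    have "map f [m..<m + Suc k] = map f [m'..<m' + Suc k]"
      by (rule inj_onD[OF inj]) (simp add: that, unfold factors_eq_range, rule rangeI, rule rangeI)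
    then show ?thesis by simp
  qed
  obtain m m' where m: "m < m'" "map f [m..<m + k] = map f [m'..<m' + k]"
  proof -
    have "\<not> inj (\<lambda>i. map f [i..<i + k])"
      using fin[of k] by (metis factors_eq_range finite_imageD infinite_UNIV_nat)
    then obtain a b where "a \<noteq> b" "map f [a..<a + k] = map f [b..<b + k]"
      unfolding inj_def by blast
    then show thesis
      using that by (metis linorder_neqE_nat)
  qed
  have win: "map f [m + j..<m + j + k] = map f [m' + j..<m' + j + k]" for j
  proof (induction j)
    case (Suc j)
    have "map f [m + j..<m + j + k] @ [f (m + j + k)] = map f [m' + j..<m' + j + k] @ [f (m' + j + k)]"
      using Suc step[OF Suc] by simp
    then have "map f [m + j..<Suc (m + j + k)] = map f [m' + j..<Suc (m' + j + k)]"
      by simp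
    then have "tl (map f [m + j..<Suc (m + j + k)]) = tl (map f [m' + j..<Suc (m' + j + k)])"
      by (rule arg_cong)
    then show ?case by (simp add: upt_conv_Cons del: upt_Suc)
  qed (use m in simp)
  have "f (j + (m' - m)) = f j" if "j \<ge> m + k" for j
    using step[OF win[of "j - m - k"]] that m(1) by (simp add: add.commute)
  then show ?thesis
    unfolding eventually_periodic_def using m(1) zero_less_diff by blast
qed

text \<open>An eventually periodic word has at most \<open>N + p\<close> distinct windows of any
  length, too few at length \<open>N + p\<close>.\<close>

lemma minimal_complexity_aperiodic:
  assumes "minimal_complexity f"
  shows "\<not> eventually_periodic f"
proof
  assume "eventually_periodic f"
  then obtain N p where p: "p > 0" "\<And>m. m \<ge> N \<Longrightarrow> f (m + p) = f m"
    unfolding eventually_periodic_def by blast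
  have red: "\<exists>j<N + p. map f [i..<i + n] = map f [j..<j + n]" for i n
  proof (induction i rule: less_induct)
    case (less i)
    show ?case
    proof (cases "i < N + p")
      case False
      have "f (i + j) = f (i - p + j)" for j
        using p(2)[of "i - p + j"] False by simp
      then have "map f [i..<i + n] = map f [i - p..<i - p + n]"
        unfolding map_upt_add by simp
      with less[of "i - p"] False p(1) show ?thesis by simp
    qed auto
  qed
  let ?n = "N + p"
  have "factors f ?n \<subseteq> (\<lambda>j. map f [j..<j + ?n]) ` {..<?n}"
    using red[of _ ?n] by (auto simp: factors_eq_range)
  then have "card (factors f ?n) \<le> ?n"
    by (metis card_lessThan finite_lessThan surj_card_le)
  then show False
    using assms by (simp add: minimal_complexity_def)
qed

lemma eventually_periodic_tail:
  "eventually_periodic (\<lambda>i. f (t + i)) \<Longrightarrow> eventually_periodic f"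
proof -
  assume "eventually_periodic (\<lambda>i. f (t + i))"
  then obtain N p where p: "p > 0" "\<And>m. m \<ge> N \<Longrightarrow> f (t + (m + p)) = f (t + m)"
    unfolding eventually_periodic_def by blast
  have "f (m + p) = f m" if "m \<ge> t + N" for m
    using p(2)[of "m - t"] that by simp
  with p(1) show ?thesis
    unfolding eventually_periodic_def by blast
qed

text \<open>If a factor of length \<open>n\<close> did not return at or beyond \<open>N\<close>, the
  tail from \<open>N\<close> would have at most \<open>n\<close> factors of that length, hence be
  eventually periodic, and so would \<open>f\<close>.\<close>

lemma minimal_complexity_recurrent:
  assumes "minimal_complexity f"
  shows "\<exists>j\<ge>N. map f [j..<j + n] = map f [i..<i + n]"
proof (rule ccontr)
  assume contra: "\<not> ?thesis"
  let ?g = "\<lambda>i. f (N + i)"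
  have sub: "factors ?g k \<subseteq> factors f k" for k
    by (auto simp: factors_def factor_tail)
  have "map f [i..<i + n] \<notin> factors ?g n"
  proof
    assume "map f [i..<i + n] \<in> factors ?g n"
    then obtain j where "map f [i..<i + n] = map f [N + j..<N + j + n]"
      unfolding factors_eq_range map_upt_add by (auto simp only: add.assoc)
    with contra show False by (metis le_add1)
  qed
  moreover have "map f [i..<i + n] \<in> factors f n"
    by (auto simp: factors_eq_range)
  ultimately have "factors ?g n \<subset> factors f n"
    using sub by blast
  then have "card (factors ?g n) \<le> n"
    using assms psubset_card_mono[OF minimal_complexity_finite[OF assms]]
    by (metis Suc_eq_plus1 less_Suc_eq_le minimal_complexity_def)
  then have "eventually_periodic ?g"
    using finite_subset[OF sub minimal_complexity_finite[OF assms]]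
    by (intro eventually_periodic_if_low_complexity)
  then show False
    using assms eventually_periodic_tail minimal_complexity_aperiodic by blast
qed

text \<open>If two right special words of length \<open>n\<close> differed, one extension of each
  could be discarded from the \<open>n + 2\<close> factors of length \<open>n + 1\<close> and
  truncation would still be onto, leaving at most \<open>n\<close> factors of length
  \<open>n\<close>.\<close>

lemma unique_right_special:
  assumes "minimal_complexity f" "length u = length w"
    "factor (u @ [a]) f" "factor (u @ [b]) f" "a \<noteq> b"
    "factor (w @ [c]) f" "factor (w @ [d]) f" "c \<noteq> d"
  shows "u = w"
proof (rule ccontr)
  assume "u \<noteq> w"
  let ?n = "length u"
  let ?A = "factors f (Suc ?n) - {u @ [a], w @ [c]}"
  have in': "u @ [a] \<in> factors f (Suc ?n)" "w @ [c] \<in> factors f (Suc ?n)"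
    "u @ [b] \<in> ?A" "w @ [d] \<in> ?A"
    using assms \<open>u \<noteq> w\<close> by (auto simp: factors_def)
  have "factors f ?n \<subseteq> butlast ` ?A"
  proof
    fix x assume "x \<in> factors f ?n"
    then obtain y where "y \<in> factors f (Suc ?n)" "x = butlast y"
      using butlast_factors by blast
    then show "x \<in> butlast ` ?A"
      using in'(3,4) by (cases "y = u @ [a]"; cases "y = w @ [c]") (force+)
  qed
  moreover have fin: "finite ?A"
    using assms(1) minimal_complexity_finite by blast
  ultimately have "card (factors f ?n) \<le> card ?A"
    by (metis surj_card_le)
  also have "card ?A = card (factors f (Suc ?n)) - card {u @ [a], w @ [c]}"
    using in' by (intro card_Diff_subset) auto
  finally show False
    using assms(1) \<open>u \<noteq> w\<close> by (simp add: minimal_complexity_def)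
qed

lemma minimal_complexity_comp:
  assumes "minimal_complexity f" "inj_on h (range f)"
  shows "minimal_complexity (h \<circ> f)"
proof -
  have "factors (h \<circ> f) n = map h ` factors f n" for n
    by (simp add: factors_eq_range image_image)
  moreover have "inj_on (map h) (factors f n)" for n
    by (rule inj_on_mapI, rule inj_on_subset[OF assms(2)]) (auto simp: factors_eq_range)
  ultimately show ?thesis
    using assms(1) by (simp add: minimal_complexity_def card_image)
qed

lemma minimal_complexity_card_range:
  assumes "minimal_complexity f"
  shows "card (range f) = 2"
proof -
  have "factors f 1 = (\<lambda>a. [a]) ` range f"
    by (simp add: factors_eq_range image_image)
  moreover have "card (factors f 1) = 2"
    using assms by (simp add: minimal_complexity_def)
  ultimately show ?thesis
    by (simp add: card_image inj_on_def)
qed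

section \<open>Words over two letters\<close>

lemma factor_two_letters: "factor [a, b] f \<longleftrightarrow> (\<exists>i. f i = a \<and> f (Suc i) = b)"
  by (auto simp: factor_def upt_rec)

text \<open>Otherwise the word would be constant from some \<open>a\<close> on.\<close>

lemma two_letter_switch:
  assumes "minimal_complexity f" "range f = {a, b}" "a \<noteq> b"
  shows "factor [a, b] f"
proof (rule ccontr)
  assume *: "\<not> factor [a, b] f"
  obtain i where i: "f i = a"
    using assms(2) by (metis insertI1 rangeE)
  have "f (i + j) = a" for j
  proof (induction j)
    case (Suc j)
    moreover have "f (i + Suc j) \<in> {a, b}"
      using assms(2) by blast
    ultimately show ?case
      using * by (auto simp: factor_two_letters)
  qed (use i in simp)
  then have "f (m + 1) = f m" if "m \<ge> i" for m
    using that by (metis add.assoc le_add_diff_inverse)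
  then show False
    using minimal_complexity_aperiodic[OF assms(1)] unfolding eventually_periodic_def
    by (metis zero_less_one)
qed

text \<open>Both letter changes occur, so both squares together with them would give four factors of
  length 2 instead of three.\<close>

lemma isolated_letter:
  assumes "minimal_complexity f" "range f = {a, b}" "a \<noteq> b"
  shows "\<not> factor [a, a] f \<or> \<not> factor [b, b] f"
proof (rule ccontr)
  assume "\<not> ?thesis"
  then have "{[a, a], [b, b], [a, b], [b, a]} \<subseteq> factors f 2"
    using two_letter_switch[OF assms] two_letter_switch[of f b a] assms
    by (auto simp: factors_def insert_commute)
  then have "card {[a, a], [b, b], [a, b], [b, a]} \<le> card (factors f 2)"
    using minimal_complexity_finite[OF assms(1)] card_mono by blast
  then show False
    using assms(1,3) by (simp add: minimal_complexity_def)
qed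

section \<open>The gaps between zeros\<close>

definition zero_pos :: "(nat \<Rightarrow> bool) \<Rightarrow> nat \<Rightarrow> nat" where
  "zero_pos y = enumerate {m. \<not> y m}"

text \<open>The number of ones between two consecutive zeros; ones before the first zero are not
  recorded.\<close>

definition gap :: "(nat \<Rightarrow> bool) \<Rightarrow> nat \<Rightarrow> nat" where
  "gap y n = zero_pos y (Suc n) - zero_pos y n - 1"

text \<open>A gap is written after the zero that opens it. The zero closing the last gap is absent,
  hence the recurring \<open>decode u @ [False]\<close>.\<close>

definition decode :: "nat list \<Rightarrow> bool list" where
  "decode u = concat (map (\<lambda>k. False # replicate k True) u)"

lemma decode_simps [simp]:
  "decode [] = []"
  "decode (k # u) = False # replicate k True @ decode u"
  "decode (u @ w) = decode u @ decode w"
  by (auto simp: decode_def)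

lemma count_list_decode: "count_list (decode u) False = length u"
  by (induction u) (auto simp: count_list_0_iff)

lemma decode_inj: "decode u = decode w \<Longrightarrow> u = w"
proof (induction u arbitrary: w)
  case Nil
  then show ?case by (cases w) auto
next
  case (Cons k u)
  then obtain l w' where w: "w = l # w'"
    by (cases w) auto
  \<comment> \<open>The ones after the leading zero recover the first gap.\<close>
  have tw: "takeWhile id (replicate m True @ decode v) = replicate m True" for m v
    by (cases v) (auto simp: takeWhile_append)
  have "replicate k True @ decode u = replicate l True @ decode w'"
    using Cons.prems w by simp
  then have "k = l"
    by (metis tw length_replicate)
  with Cons w show ?case by simp
qed

context
  fixes y :: "nat \<Rightarrow> bool"
  assumes inf: "infinite {m. \<not> y m}"
begin

lemma not_at_zero_pos: "\<not> y (zero_pos y n)"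
  using enumerate_in_set[OF inf] by (simp add: zero_pos_def)

lemma zero_pos_less_Suc: "zero_pos y n < zero_pos y (Suc n)"
  using enumerate_step[OF inf] by (simp add: zero_pos_def)

lemma zero_pos_mono: "i \<le> j \<Longrightarrow> zero_pos y i \<le> zero_pos y j"
  by (rule lift_Suc_mono_le[of "zero_pos y", OF less_imp_le[OF zero_pos_less_Suc]])

lemma zero_pos_Suc: "zero_pos y (Suc n) = zero_pos y n + gap y n + 1"
  using zero_pos_less_Suc[of n] by (simp add: gap_def)

lemma range_zero_pos: "range (zero_pos y) = {m. \<not> y m}"
  using range_enumerate[OF inf] by (simp add: zero_pos_def)

lemma between_zero_pos: "zero_pos y n < m \<Longrightarrow> m < zero_pos y (Suc n) \<Longrightarrow> y m"
  using not_less_Least[of m "\<lambda>s. s \<in> {m. \<not> y m} \<and> zero_pos y n < s"] enumerate_Suc''[OF inf, of n]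
  by (auto simp: zero_pos_def)

lemma decode_gap: "i \<le> j \<Longrightarrow> decode (map (gap y) [i..<j]) = map y [zero_pos y i..<zero_pos y j]"
proof (induction j rule: dec_induct)
  case (step n)
  have *: "map y [zero_pos y n..<zero_pos y (Suc n)] = False # replicate (gap y n) True"
    using not_at_zero_pos between_zero_pos[of n]
    by (intro nth_equalityI) (auto simp: zero_pos_Suc nth_Cons' simp del: upt_Suc)
  have "[zero_pos y i..<zero_pos y (Suc n)] = [zero_pos y i..<zero_pos y n] @ [zero_pos y n..<zero_pos y (Suc n)]"
    using zero_pos_mono[OF step(1)] zero_pos_less_Suc[of n] by (metis le_add_diff_inverse less_imp_le upt_add_eq_append)
  then show ?case
    using step * by simp
qed simp

lemma factor_decode:
  assumes "factor u (gap y)"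
  shows "factor (decode u @ [False]) y"
proof -
  obtain i where "u = map (gap y) [i..<i + length u]"
    using assms factor_def by blast
  then have "decode u = map y [zero_pos y i..<zero_pos y (i + length u)]"
    using decode_gap[of i "i + length u"] by simp
  moreover have "map y [zero_pos y i..<Suc (zero_pos y (i + length u))] =
      map y [zero_pos y i..<zero_pos y (i + length u)] @ [False]"
    using zero_pos_mono[of i "i + length u"] not_at_zero_pos by simp
  ultimately show ?thesis
    by (metis factor_map_upt)
qed

text \<open>The period \<open>T\<close> of \<open>y\<close> is the distance covered by one period of
  gaps.\<close>

lemma eventually_periodic_if_gap:
  assumes "eventually_periodic (gap y)"
  shows "eventually_periodic y"
proof -
  obtain N p where p: "p > 0" "\<And>m. m \<ge> N \<Longrightarrow> gap y (m + p) = gap y m"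
    using assms unfolding eventually_periodic_def by blast
  define T where "T = zero_pos y (N + p) - zero_pos y N"
  have le: "zero_pos y N \<le> zero_pos y (N + p)"
    by (simp add: zero_pos_mono)
  have shift: "zero_pos y (n + p) = zero_pos y n + T" if "n \<ge> N" for n
    using that
  proof (induction n rule: dec_induct)
    case (step n)
    then show ?case
      using zero_pos_Suc[of n] zero_pos_Suc[of "n + p"] p(2)[of n] by simp
  qed (use le in \<open>simp add: T_def\<close>)
  have "T > 0"
    using p(1) zero_pos_less_Suc[of N] zero_pos_mono[of "Suc N" "N + p"] by (simp add: T_def)
  \<comment> \<open>From \<open>zero_pos y N\<close> on, the zeros are exactly those of index at
    least \<open>N\<close>, so it suffices to translate them by \<open>T\<close>.\<close>
  have iff: "\<not> y m \<longleftrightarrow> (\<exists>n\<ge>N. m = zero_pos y n)" if "m \<ge> zero_pos y N" for m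
  proof
    assume "\<not> y m"
    then obtain n where n: "m = zero_pos y n"
      using range_zero_pos by blast
    show "\<exists>n\<ge>N. m = zero_pos y n"
    proof (cases "n \<ge> N")
      case False
      then have "zero_pos y n < zero_pos y N"
        using zero_pos_less_Suc[of n] zero_pos_mono[of "Suc n" N] by simp
      with n that show ?thesis by simp
    qed (use n in blast)
  qed (use not_at_zero_pos in blast)
  have "y (m + T) = y m" if m: "m \<ge> zero_pos y N" for m
  proof -
    have "(\<exists>n\<ge>N. m + T = zero_pos y n) \<longleftrightarrow> (\<exists>n\<ge>N. m = zero_pos y n)"
    proof
      assume "\<exists>n\<ge>N. m + T = zero_pos y n"
      then obtain n where n: "n \<ge> N" "m + T = zero_pos y n" by blast
      have "n \<ge> N + p"
      proof (rule ccontr)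
        assume "\<not> n \<ge> N + p"
        then have "zero_pos y n < zero_pos y (N + p)"
          using zero_pos_less_Suc[of n] zero_pos_mono[of "Suc n" "N + p"] by simp
        with shift[of N] n m show False by simp
      qed
      then have "m = zero_pos y (n - p)"
        using shift[of "n - p"] n by simp
      moreover have "n - p \<ge> N" using \<open>n \<ge> N + p\<close> by simp
      ultimately show "\<exists>n\<ge>N. m = zero_pos y n" by blast
    next
      assume "\<exists>n\<ge>N. m = zero_pos y n"
      then show "\<exists>n\<ge>N. m + T = zero_pos y n"
        using shift by (metis trans_le_add1)
    qed
    then show ?thesis
      using iff[of m] iff[of "m + T"] m by auto
  qed
  then show ?thesis
    unfolding eventually_periodic_def using \<open>T > 0\<close> by blast
qed

end

text \<open>After \<open>u\<close> and \<open>j\<close> ones, an occurrence with last gap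
  \<open>j\<close> continues with a zero, one with the larger gap \<open>k\<close> continues with a
  one.\<close>

lemma gap_right_special:
  assumes "infinite {m. \<not> y m}" "factor (u @ [j]) (gap y)" "factor (u @ [k]) (gap y)" "j < k"
  shows "factor (decode (u @ [j]) @ [False]) y" "factor (decode (u @ [j]) @ [True]) y"
proof -
  show "factor (decode (u @ [j]) @ [False]) y"
    using assms factor_decode by blast
  have "replicate k True = replicate j True @ True # replicate (k - j - 1) True"
    using assms(4) by (simp flip: replicate_Suc replicate_add)
  then have "sublist (decode (u @ [j]) @ [True]) (decode (u @ [k]) @ [False])"
    by (auto simp: sublist_def)
  then show "factor (decode (u @ [j]) @ [True]) y"
    using factor_decode[OF assms(1,3)] factor_sublist by blast
qed

text \<open>Both decodings contain equally many zeros, so \<open>z\<close> has none; but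
  \<open>decode w\<close> begins with a zero, so \<open>z\<close> is empty.\<close>

lemma decode_suffix:
  assumes "decode w = z @ decode u" "length u = length w" "w \<noteq> []"
  shows "u = w"
proof -
  have "count_list z False = 0"
    using arg_cong[OF assms(1), of "\<lambda>x. count_list x False"] assms(2) by (simp add: count_list_decode)
  moreover have "hd (decode w) = False" "decode w \<noteq> []"
    using assms(3) by (cases w; simp)+
  ultimately have "z = []"
    using assms(1) by (cases z) (auto split: if_splits)
  then show ?thesis
    using assms(1) decode_inj by simp
qed

text \<open>Fixing the smaller continuation as well excludes a third one: with
  \<open>a < b < c\<close> after the same word, both \<open>a\<close> and \<open>b\<close> would be
  the smaller of a pair.\<close>

lemma gap_unique_right_special:
  assumes mc: "minimal_complexity y" and inf: "infinite {m. \<not> y m}"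
    and u: "factor (u @ [j]) (gap y)" "factor (u @ [j']) (gap y)" "j < j'"
    and w: "factor (w @ [k]) (gap y)" "factor (w @ [k']) (gap y)" "k < k'"
    and len: "length u = length w"
  shows "u = w \<and> j = k"
proof -
  have main: "p = q" if "factor (decode p @ [False]) y" "factor (decode p @ [True]) y"
    "factor (decode q @ [False]) y" "factor (decode q @ [True]) y"
    "length (decode p) \<le> length (decode q)" "length p = length q" "p \<noteq> []" for p q
  proof -
    define z where "z = take (length (decode q) - length (decode p)) (decode q)"
    define v where "v = drop (length (decode q) - length (decode p)) (decode q)"
    have zv: "decode q = z @ v" "length v = length (decode p)"
      using that by (auto simp: z_def v_def)
    \<comment> \<open>A suffix of a right special word is right special; \<open>v\<close> is cut to
      the length of \<open>decode p\<close>.\<close>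
    have "factor (v @ [x]) y" for x
    proof -
      have "factor (decode q @ [x]) y"
        using that by (cases x) auto
      moreover have "sublist (v @ [x]) (decode q @ [x])"
        using zv by (auto simp: sublist_def)
      ultimately show ?thesis
        using factor_sublist by blast
    qed
    then have "decode p = v"
      using unique_right_special[OF mc _ that(1,2)] zv(2) by (metis (full_types))
    then show "p = q"
      using zv(1) that by (metis decode_suffix length_0_conv)
  qed
  note R = gap_right_special[OF inf u] gap_right_special[OF inf w]
  have "u @ [j] = w @ [k]"
  proof (cases "length (decode (u @ [j])) \<le> length (decode (w @ [k]))")
    case True
    then show ?thesis
      using main[OF R True] len by simp
  next
    case False
    then have "length (decode (w @ [k])) \<le> length (decode (u @ [j]))" by simp
    then show ?thesis
      using main[OF R(3,4,1,2)] len by simp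
  qed
  then show ?thesis by simp
qed

lemma infinite_zeros:
  assumes "minimal_complexity y"
  shows "infinite {m. \<not> y m}"
proof
  assume "finite {m. \<not> y m}"
  then obtain N where "\<forall>m\<in>{m. \<not> y m}. m < N"
    by (meson finite_nat_set_iff_bounded)
  then have "y (m + 1) = y m" if "m \<ge> N" for m
    using that by (metis mem_Collect_eq not_le trans_le_add1)
  then show False
    using minimal_complexity_aperiodic[OF assms] unfolding eventually_periodic_def
    by (metis zero_less_one)
qed

lemma factors_Suc_butlast_eq:
  assumes "p \<in> factors f (Suc n)" "q \<in> factors f (Suc n)" "butlast p = butlast q"
  obtains w k l where "p = w @ [k]" "q = w @ [l]" "length w = n"
proof -
  have "length p = Suc n" "length q = Suc n"
    using assms(1,2) by (auto simp: factors_def)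
  then show thesis
    using that[of "butlast p" "last p" "last q"] assms(3)
    by (metis append_butlast_last_id diff_Suc_1 length_0_conv length_butlast nat.distinct(1))
qed

text \<open>Two right special words of equal length over the gap alphabet decode to right special
  words one of which is a suffix of the other, so they agree.\<close>

lemma minimal_complexity_gap:
  assumes mc: "minimal_complexity y"
  shows "minimal_complexity (gap y)"
proof -
  let ?s = "gap y"
  note inf = infinite_zeros[OF mc]
  have bound: "finite (factors ?s n) \<and> card (factors ?s n) \<le> n + 1" for n
  proof (induction n)
    case (Suc n)
    \<comment> \<open>Truncation becomes injective after removal of a single word, so the complexity
      grows by at most one per step.\<close>
    have "\<exists>v. inj_on butlast (factors ?s (Suc n) - {v})"
    proof (cases "\<exists>u j j'. length u = n \<and> factor (u @ [j]) ?s \<and> factor (u @ [j']) ?s \<and> j < j'")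
      case True
      then obtain u j j' where u: "length u = n" "factor (u @ [j]) ?s" "factor (u @ [j']) ?s" "j < j'"
        by blast
      have eq: "w = u \<and> k = j" if "length w = n" "factor (w @ [k]) ?s" "factor (w @ [k']) ?s" "k < k'" for w k k'
        using gap_unique_right_special[OF mc inf that(2-4) u(2-4)] that(1) u(1) by simp
      have "p = q" if p: "p \<in> factors ?s (Suc n) - {u @ [j']}" and q: "q \<in> factors ?s (Suc n) - {u @ [j']}"
        and pq: "butlast p = butlast q" for p q
      proof (rule ccontr)
        assume "p \<noteq> q"
        obtain w k l where w: "p = w @ [k]" "q = w @ [l]" "length w = n"
          using factors_Suc_butlast_eq[OF _ _ pq] p q by blast
        \<comment> \<open>Here \<open>w = u\<close> and \<open>k = j\<close>, so \<open>l\<close>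
          and \<open>j'\<close> are distinct continuations above \<open>j\<close>; the smaller of
          them would have to equal \<open>j\<close>.\<close>
        have *: False if "factor (w @ [k]) ?s" "factor (w @ [l]) ?s" "k < l" "w @ [l] \<noteq> u @ [j']" for k l
        proof -
          have "w = u" "k = j"
            using eq[OF w(3) that(1-3)] by auto
          moreover have "l \<noteq> j'" using that(4) \<open>w = u\<close> by simp
          ultimately show False
            using eq[OF u(1), of "min l j'" "max l j'"] that u
            by (cases "l < j'") (auto simp: min_def max_def split: if_splits)
        qed
        show False
          using *[of k l] *[of l k] p q w \<open>p \<noteq> q\<close>
          by (cases k l rule: linorder_cases) (auto simp: factors_def)
      qed
      then show ?thesis by (auto intro!: exI[of _ "u @ [j']"] inj_onI)
    next
      case False
      have "inj_on butlast (factors ?s (Suc n))"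
      proof (rule inj_onI, rule ccontr)
        fix p q assume p: "p \<in> factors ?s (Suc n)" "q \<in> factors ?s (Suc n)" "butlast p = butlast q" "p \<noteq> q"
        obtain w k l where w: "p = w @ [k]" "q = w @ [l]" "length w = n"
          using factors_Suc_butlast_eq[OF p(1-3)] by blast
        show False
          using False p w by (cases k l rule: linorder_cases) (auto simp: factors_def)
      qed
      then show ?thesis using inj_on_diff by blast
    qed
    then obtain v where v: "inj_on butlast (factors ?s (Suc n) - {v})" ..
    have img: "butlast ` (factors ?s (Suc n) - {v}) \<subseteq> factors ?s n"
      using butlast_factors[of ?s n] by blast
    have "finite (factors ?s (Suc n) - {v})" "card (factors ?s (Suc n) - {v}) \<le> n + 1"
      using inj_on_finite[OF v img] card_inj_on_le[OF v img] Suc by auto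
    then show ?case
      by (auto simp: card_Diff_singleton_if split: if_splits)
  qed (simp add: factors_0)
  moreover have "\<not> eventually_periodic ?s"
    using eventually_periodic_if_gap[OF inf] minimal_complexity_aperiodic[OF mc] by blast
  ultimately have "card (factors ?s n) > n" for n
    using eventually_periodic_if_low_complexity[of ?s n] by (meson not_le)
  with bound show ?thesis
    unfolding minimal_complexity_def by (metis Suc_eq_plus1 Suc_leI le_antisym)
qed

text \<open>If the larger gap were at least \<open>a + 2\<close>, the block of \<open>a + 1\<close>
  ones would be right special inside it, besides the equally long \<open>decode [a]\<close>.\<close>

lemma gap_values:
  assumes mc: "minimal_complexity y"
  obtains a where "range (gap y) = {a, Suc a}"
proof -
  note inf = infinite_zeros[OF mc]
  obtain a b where ab: "range (gap y) = {a, b}" "a < b"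
    using minimal_complexity_card_range[OF minimal_complexity_gap[OF mc]]
    by (metis card_2_iff insert_commute linorder_neqE_nat)
  have fac: "factor ([] @ [a]) (gap y)" "factor ([] @ [b]) (gap y)"
  proof -
    have "\<exists>i. gap y i = a" "\<exists>i. gap y i = b"
      using ab(1) by (metis insertCI rangeE)+
    then show "factor ([] @ [a]) (gap y)" "factor ([] @ [b]) (gap y)"
      by (auto simp: factor_def)
  qed
  have "b = Suc a"
  proof (rule ccontr)
    assume "b \<noteq> Suc a"
    then have r: "replicate b True = replicate (b - a - 2) True @ replicate (Suc a) True @ [True]"
      using ab(2) by (intro nth_equalityI) (auto simp: nth_append simp del: replicate_Suc)
    have r': "replicate b True = replicate (b - a - 1) True @ replicate (Suc a) True"
      using ab(2) by (simp flip: replicate_Suc replicate_add)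
    have b: "factor (decode [b] @ [False]) y"
      using factor_decode[OF inf fac(2)] by simp
    have "sublist (replicate (Suc a) True @ [True]) (decode [b] @ [False])"
      unfolding sublist_def decode_simps r
      by (intro exI[of _ "False # replicate (b - a - 2) True"] exI[of _ "[False]"]) simp
    moreover have "sublist (replicate (Suc a) True @ [False]) (decode [b] @ [False])"
      unfolding sublist_def decode_simps r'
      by (intro exI[of _ "False # replicate (b - a - 1) True"] exI[of _ "[]"]) simp
    ultimately have "factor (replicate (Suc a) True @ [True]) y" "factor (replicate (Suc a) True @ [False]) y"
      using b factor_sublist by blast+
    moreover have "factor (decode [a] @ [False]) y" "factor (decode [a] @ [True]) y"
      using gap_right_special[OF inf fac ab(2)] by auto
    ultimately have "replicate (Suc a) True = decode [a]"
      by (intro unique_right_special[OF mc]) auto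
    then show False by simp
  qed
  with ab(1) that show thesis by blast
qed

section \<open>Rank-one constructions\<close>

lemma rotate_mult:
  assumes "rotate d w = w"
  shows "rotate (d * q) w = w"
proof (induction q)
  case (Suc q)
  then show ?case
    using assms by (metis mult_Suc_right rotate_rotate)
qed simp

lemma count_list_rotate: "count_list (rotate r w) x = count_list w x"
proof -
  have "count_list (rotate r w) x = count_list (take (r mod length w) w @ drop (r mod length w) w) x"
    by (simp add: rotate_drop_take del: append_take_drop_id)
  then show ?thesis by simp
qed

text \<open>The number of rotations is the least \<open>d > 0\<close> with
  \<open>rotate d w = w\<close>, and \<open>length w\<close> also fixes \<open>w\<close>.\<close>

lemma card_rotations_dvd:
  assumes "w \<noteq> []"
  shows "card (range (\<lambda>r. rotate r w)) dvd length w"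
proof -
  let ?P = "\<lambda>d. d > 0 \<and> rotate d w = w"
  define d where "d = (LEAST d. ?P d)"
  have "?P (length w)"
    using assms by simp
  then have d: "d > 0" "rotate d w = w"
    unfolding d_def by (metis (mono_tags, lifting) LeastI)+
  have least: "rotate e w \<noteq> w" if "0 < e" "e < d" for e
    using not_less_Least[of e ?P] that unfolding d_def by blast
  have mod: "rotate r w = rotate (r mod d) w" for r
    using rotate_mult[OF d(2), of "r div d"] by (metis mod_mult_div_eq rotate_rotate)
  have neq: "rotate i w \<noteq> rotate j w" if "i < j" "j < d" for i j
  proof
    assume eq: "rotate i w = rotate j w"
    \<comment> \<open>Rotating by \<open>?N\<close> completes \<open>i\<close> to a multiple of the
      length and so undoes \<open>rotate i\<close>.\<close>
    let ?N = "length w * i - i"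
    have le: "i \<le> length w * i"
      using assms by (cases w) auto
    have "w = rotate (?N + i) w"
      using rotate_mult[of "length w" w i] le by simp
    also have "\<dots> = rotate (?N + j) w"
      using eq by (metis rotate_rotate)
    also have "?N + j = (j - i) + length w * i"
      using le that(1) by simp
    also have "rotate ((j - i) + length w * i) w = rotate (j - i) w"
      using rotate_mult[of "length w" w i] by (metis rotate_id mod_self rotate_rotate)
    finally have "rotate (j - i) w = w"
      by (rule sym)
    then show False
      using least[of "j - i"] that by simp
  qed
  have "range (\<lambda>r. rotate r w) = (\<lambda>r. rotate r w) ` {..<d}"
    using mod d(1) by (auto intro!: image_eqI[of _ _ "_ mod d"])
  moreover have "inj_on (\<lambda>r. rotate r w) {..<d}"
    using neq by (intro inj_onI) (metis lessThan_iff linorder_neqE_nat)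
  ultimately have "card (range (\<lambda>r. rotate r w)) = d"
    by (simp add: card_image)
  moreover have "length w mod d = 0"
    using least[of "length w mod d"] mod[of "length w"] d(1) by (metis \<open>0 < length w \<and> rotate (length w) w = w\<close> mod_less_divisor neq0_conv)
  ultimately show ?thesis
    by (simp add: dvd_eq_mod_eq_0)
qed

lemma constant_if_one_rotation:
  assumes "card (range (\<lambda>r. rotate r w)) = 1" "x \<in> set w"
  shows "x = w ! 0"
proof -
  have one: "rotate r w = w" for r
    using assms(1) by (metis card_1_singletonE rangeI rotate0 id_apply singletonD)
  obtain m where "m < length w" "x = w ! m"
    using assms(2) by (metis in_set_conv_nth)
  then show ?thesis
    using nth_rotate[of 0 w m] one[of m] by (cases w) auto
qed

text \<open>If all positions outside one residue class mod \<open>L\<close> repeat the word \<open>C\<close>, the factors of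
  length \<open>L\<close> are the rotations of \<open>C @ [a]\<close> and of \<open>C @ [b]\<close>. The numbers of rotations divide
  \<open>L\<close> and add up to \<open>L + 1\<close>, so one of the two words is constant.\<close>

lemma toeplitz_block_constant:
  assumes mc: "minimal_complexity s"
    and C: "\<And>m. m mod Suc (length C) < length C \<Longrightarrow> s m = C ! (m mod Suc (length C))"
    and x: "x \<in> set C" and y: "y \<in> set C"
  shows "x = y"
proof -
  define L where "L = Suc (length C)"
  let ?orb = "\<lambda>w. range (\<lambda>r. rotate r w)"
  \<comment> \<open>A window of length \<open>L\<close> contains exactly one hole, a position of
    residue \<open>length C\<close>: the last position of the block containing
    \<open>m\<close>.\<close>
  have win: "map s [m..<m + L] = rotate (m mod L) (C @ [s (m - m mod L + length C)])" (is "_ = rotate _ ?w") for m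
  proof (rule nth_equalityI)
    fix j assume "j < length (map s [m..<m + L])"
    then have j: "j < L" by simp
    have "rotate (m mod L) ?w ! j = ?w ! ((m mod L + j) mod L)"
      using j nth_rotate[of j ?w "m mod L"] by (simp add: L_def)
    also have "\<dots> = ?w ! ((m + j) mod L)"
      by (simp add: mod_add_left_eq)
    also have "\<dots> = s (m + j)"
    proof (cases "(m + j) mod L < length C")
      case True
      then show ?thesis
        using C[of "m + j"] by (simp add: nth_append L_def)
    next
      case False
      have "(m + j) mod L < Suc (length C)" by (simp add: L_def)
      with False have eq: "(m + j) mod L = length C" by linarith
      then have eq': "(m mod L + j) mod L = length C" by (simp add: mod_add_left_eq)
      have "m mod L < L" by (simp add: L_def)
      have "m mod L + j = length C"
      proof (cases "m mod L + j < L")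
        case False
        moreover have "m mod L + j - L < L"
          using False j \<open>m mod L < L\<close> by linarith
        ultimately have "(m mod L + j) mod L = m mod L + j - L"
          by (metis le_mod_geq mod_less not_le)
        then show ?thesis
          using eq' j \<open>m mod L < L\<close> unfolding L_def by linarith
      qed (use eq' in simp)
      then have "m - m mod L + length C = m + j"
        using mod_less_eq_dividend[of m L] by linarith
      then show ?thesis
        using eq by (simp add: nth_append)
    qed
    finally show "map s [m..<m + L] ! j = rotate (m mod L) ?w ! j"
      using j by simp
  qed (simp add: L_def)
  obtain a b where ab: "range s = {a, b}" "a \<noteq> b"
    using minimal_complexity_card_range[OF mc] by (meson card_2_iff)
  \<comment> \<open>If a letter were missing from the holes, they would all carry the other one and
    \<open>s\<close> would have period \<open>L\<close>.\<close>
  have hole: "\<exists>m. m mod L = length C \<and> s m = u" if uv: "range s = {u, v}" for u v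
  proof (rule ccontr)
    assume "\<not> ?thesis"
    then have "s m = v" if "m mod L = length C" for m
      using uv that by (metis insertE rangeI singletonD)
    moreover have "m mod L = length C \<or> m mod L < length C" for m
      using mod_less_divisor[of L m] by (auto simp: L_def less_Suc_eq)
    ultimately have "s (m + L) = s m" for m
      using C[of m] C[of "m + L"] unfolding L_def by (metis mod_add_self2)
    then show False
      using minimal_complexity_aperiodic[OF mc] unfolding eventually_periodic_def L_def by blast
  qed
  have sub: "?orb (C @ [u]) \<subseteq> factors s L" if uv: "range s = {u, v}" for u v
  proof
    fix w assume "w \<in> ?orb (C @ [u])"
    then obtain r where "w = rotate r (C @ [u])" by blast
    then have w: "w = rotate (r mod L) (C @ [u])"
      using rotate_conv_mod[of r "C @ [u]"] by (simp add: L_def)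
    obtain m0 where m0: "m0 mod L = length C" "s m0 = u"
      using hole[OF uv] by blast
    define m where "m = m0 - length C + r mod L"
    have "L dvd m0 - length C"
      using m0(1) by (metis dvd_minus_mod)
    then have "m mod L = r mod L"
      unfolding m_def by (metis add_0 dvd_imp_mod_0 mod_add_left_eq mod_mod_trivial)
    moreover have "length C \<le> m0"
      using m0(1) by (metis mod_less_eq_dividend)
    ultimately have "w = map s [m..<m + L]"
      using win[of m] m0 w by (simp add: m_def)
    then show "w \<in> factors s L"
      by (auto simp: factors_eq_range)
  qed
  have "factors s L \<subseteq> ?orb (C @ [a]) \<union> ?orb (C @ [b])"
  proof
    fix w assume "w \<in> factors s L"
    then obtain m where m: "w = map s [m..<m + L]"
      by (auto simp: factors_eq_range)
    have "s (m - m mod L + length C) \<in> {a, b}"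
      using ab(1) by blast
    then show "w \<in> ?orb (C @ [a]) \<union> ?orb (C @ [b])"
      using m win[of m] by auto
  qed
  then have eq: "factors s L = ?orb (C @ [a]) \<union> ?orb (C @ [b])"
    using sub[of a b] sub[of b a] ab(1) by (auto simp: insert_commute)
  \<comment> \<open>Rotation preserves letter counts, and \<open>a\<close> occurs once more in
    \<open>C @ [a]\<close> than in \<open>C @ [b]\<close>.\<close>
  have "?orb (C @ [a]) \<inter> ?orb (C @ [b]) = {}"
  proof (rule ccontr)
    assume "?orb (C @ [a]) \<inter> ?orb (C @ [b]) \<noteq> {}"
    then obtain r r' where "rotate r (C @ [a]) = rotate r' (C @ [b])"
      by auto
    then have "count_list (C @ [a]) a = count_list (C @ [b]) a"
      by (metis count_list_rotate)
    then show False using ab(2) by simp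
  qed
  moreover have "finite (?orb (C @ [a]))" "finite (?orb (C @ [b]))"
    using eq minimal_complexity_finite[OF mc, of L] by auto
  ultimately have "card (factors s L) = card (?orb (C @ [a])) + card (?orb (C @ [b]))"
    unfolding eq by (intro card_Un_disjoint)
  then have sum: "card (?orb (C @ [a])) + card (?orb (C @ [b])) = L + 1"
    using mc by (metis minimal_complexity_def)
  have dvd: "card (?orb (C @ [u])) dvd L" for u
    using card_rotations_dvd[of "C @ [u]"] by (simp add: L_def)
  have half: "card (?orb (C @ [u])) = L \<or> 2 * card (?orb (C @ [u])) \<le> L" for u
  proof -
    obtain q where q: "L = card (?orb (C @ [u])) * q"
      using dvd[of u] by (rule dvdE)
    then have "q = 1 \<or> q \<ge> 2"
      by (cases q) (auto simp: L_def)
    then show ?thesis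
      using q by (auto simp: mult.commute)
  qed
  \<comment> \<open>Two counts of at most half of \<open>L\<close> cannot add up to
    \<open>L + 1\<close>, so one equals \<open>L\<close> and the other is 1.\<close>
  obtain u where "card (?orb (C @ [u])) = 1"
    using half[of a] half[of b] sum by fastforce
  then show ?thesis
    using constant_if_one_rotation x y by (metis Un_iff set_append)
qed

section \<open>Rank-one constructions in gap coordinates\<close>

definition weave :: "'a list \<Rightarrow> 'a list \<Rightarrow> 'a list" where
  "weave as C = concat (map (\<lambda>a. C @ [a]) as) @ C"

lemma weave_simps [simp]:
  "weave [] C = C"
  "weave (a # as) C = C @ a # weave as C"
  by (auto simp: weave_def)

lemma weave_append: "weave (as @ b # bs) C = weave as C @ b # weave bs C"
  by (induction as) auto

text \<open>Collapses consecutive rank-one steps into a single one.\<close>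

lemma weave_weave: "weave bs (weave as C) = weave (weave bs as) C"
  by (induction bs) (auto simp: weave_append)

lemma nth_weave:
  "m < length (weave as C) \<Longrightarrow> m mod Suc (length C) < length C \<Longrightarrow>
    weave as C ! m = C ! (m mod Suc (length C))"
proof (induction as arbitrary: m)
  case (Cons a as)
  show ?case
  proof (cases "m < length C")
    case False
    with Cons.prems(2) have "m \<noteq> length C" by auto
    with False have m: "m = m - Suc (length C) + Suc (length C)" by simp
    then have eq: "m mod Suc (length C) = (m - Suc (length C)) mod Suc (length C)"
      by (metis mod_add_self2)
    moreover have "m - Suc (length C) < length (weave as C)"
      using Cons.prems(1) m by simp
    ultimately have "weave as C ! (m - Suc (length C)) = C ! (m mod Suc (length C))"
      using Cons by simp
    moreover have "weave (a # as) C ! m = weave as C ! (m - Suc (length C))"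
      using m by (simp add: nth_append nth_Cons')
    ultimately show ?thesis by simp
  qed (simp add: nth_append)
qed simp

text \<open>The closing zero of \<open>decode C @ [False]\<close> and a spacer of \<open>a\<close>
  ones together form the single gap letter \<open>a\<close>, so a rank-one step inserts arbitrary
  letters between copies of \<open>C\<close>.\<close>

lemma built_from_decode:
  assumes "built_from_starting_with {decode C @ [False]} z w"
  shows "\<exists>as. as \<noteq> [] \<and> w = decode (weave as C) @ [False]"
proof -
  obtain k v a where kv: "k \<ge> 1" "\<forall>i\<in>{1..k + 1}. v i = decode C @ [False]" "w = spaced_word k v a"
    using assms by (auto simp: built_from_starting_with_def)
  have "concat (map (\<lambda>i. v i @ replicate (a i) True) I) @ decode C @ [False]
      = decode (weave (map a I) C) @ [False]" if "\<forall>i\<in>set I. v i = decode C @ [False]" for I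
    using that by (induction I) auto
  from this[of "[1..<k + 1]"] have "w = decode (weave (map a [1..<k + 1]) C) @ [False]"
    using kv by (simp add: spaced_word_def)
  moreover have "map a [1..<k + 1] \<noteq> []"
    using kv(1) by simp
  ultimately show ?thesis by blast
qed

lemma spacer_rank_one_structure:
  assumes "at_most_spacer_rank_construction 1 W"
  obtains C where "\<And>i. \<exists>as. as \<noteq> [] \<and> C (Suc i) = weave as (C i)"
    "\<And>i. initial_segment (decode (C i) @ [False]) W"
proof -
  obtain N :: "nat \<Rightarrow> nat" and v :: "nat \<Rightarrow> nat \<Rightarrow> bool list" where Nv: "\<forall>i. 1 \<le> N i \<and> N i \<le> 1" "\<forall>j\<in>{1..N 0}. v 0 j = [False]"
    "\<forall>i. built_from_starting_with (v i ` {1..N i}) (v i 1) (v (i + 1) 1)"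
    "\<forall>i. initial_segment (v i 1) W"
    using assms unfolding at_most_spacer_rank_construction_def by blast
  have N: "N i = 1" for i
    using Nv(1) by (simp add: le_antisym)
  have "\<exists>C. \<forall>n. v n 1 = decode (C n) @ [False] \<and> (\<exists>as. as \<noteq> [] \<and> C (Suc n) = weave as (C n))"
  proof (rule dependent_nat_choice)
    have "v 0 1 = decode [] @ [False]"
      using Nv(2) N by simp
    then show "\<exists>C. v 0 1 = decode C @ [False]" by blast
  next
    fix C n assume "v n 1 = decode C @ [False]"
    moreover have "built_from_starting_with {v n 1} (v n 1) (v (Suc n) 1)"
      using Nv(3) N by (metis Suc_eq_plus1 atLeastAtMost_singleton image_empty image_insert)
    ultimately show "\<exists>D. v (Suc n) 1 = decode D @ [False] \<and> (\<exists>as. as \<noteq> [] \<and> D = weave as C)"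
      using built_from_decode by (metis (no_types))
  qed
  then show thesis
    using that Nv(4) by metis
qed

text \<open>Equal length means equally many zeros, so the surplus has none; as the longer word ends
  in a zero, there is no surplus.\<close>

lemma decode_prefix_eq:
  assumes "prefix (decode u @ [False]) (decode w @ [False])" "length u = length w"
  shows "u = w"
proof -
  obtain z where z: "decode w @ [False] = decode u @ [False] @ z"
    using assms(1) by (auto simp: prefix_def)
  then have "count_list (decode w @ [False]) False = count_list (decode u @ [False] @ z) False"
    by simp
  then have "False \<notin> set z"
    using assms(2) by (simp add: count_list_decode count_list_0_iff)
  then have "z = []"
    using z by (metis append.assoc last_append last_in_set last_snoc)
  with z show ?thesis
    using decode_inj by simp
qed

lemma prefix_map_upt: "prefix (map f [0..<m]) (map f [0..<n]) \<or> prefix (map f [0..<n]) (map f [0..<m])"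
  by (metis linorder_linear map_mono_prefix prefixI upt_add_eq_append le_iff_add zero_le)

text \<open>The segment begins with a zero, so no ones precede the first zero of \<open>y\<close>
  and no letter is lost in passing to gaps.\<close>

lemma initial_segment_decode:
  assumes inf: "infinite {m. \<not> y m}" and init: "initial_segment (decode u @ [False]) y"
  shows "u = map (gap y) [0..<length u]"
proof -
  have "\<not> y 0"
  proof -
    have "(decode u @ [False]) ! 0 = y 0"
      using init unfolding initial_segment_def
      by (metis add_0 length_append_singleton nth_map_upt zero_less_Suc diff_zero)
    moreover have "\<not> (decode u @ [False]) ! 0"
      by (cases u) auto
    ultimately show ?thesis by simp
  qed
  then have z0: "zero_pos y 0 = 0"
    unfolding zero_pos_def by (simp add: enumerate_0 Least_eq_0)
  define w where "w = map (gap y) [0..<length u]"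
  have w: "decode w @ [False] = map y [0..<Suc (zero_pos y (length u))]"
    using decode_gap[OF inf, of 0 "length u"] not_at_zero_pos[OF inf] by (simp add: w_def z0)
  have "prefix (decode u @ [False]) (decode w @ [False]) \<or> prefix (decode w @ [False]) (decode u @ [False])"
    using w init prefix_map_upt unfolding initial_segment_def by metis
  moreover have "length u = length w"
    by (simp add: w_def)
  ultimately have "u = w"
    using decode_prefix_eq by metis
  then show ?thesis
    by (simp add: w_def)
qed

lemma weave_chain:
  assumes C: "\<And>i. \<exists>as. as \<noteq> [] \<and> C (Suc i) = weave as (C i)"
  shows "\<exists>as. C (i + j) = weave as (C i)" "i \<le> length (C i)"
proof -
  show "\<exists>as. C (i + j) = weave as (C i)"
  proof (induction j)
    case 0
    then show ?case by (intro exI[of _ "[]"]) simp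
  next
    case (Suc j)
    then show ?case
      using C[of "i + j"] weave_weave by (metis add_Suc_right)
  qed
  show "i \<le> length (C i)"
  proof (induction i)
    case (Suc i)
    obtain a as where "C (Suc i) = weave (a # as) (C i)"
      using C by (metis neq_Nil_conv)
    with Suc show ?case by simp
  qed simp
qed

lemma minimal_complexity_not_spacer_rank_one:
  assumes mc: "minimal_complexity W"
  shows "\<not> at_most_spacer_rank_construction 1 W"
proof
  assume "at_most_spacer_rank_construction 1 W"
  then obtain C where C: "\<And>i. \<exists>as. as \<noteq> [] \<and> C (Suc i) = weave as (C i)"
    and init: "\<And>i. initial_segment (decode (C i) @ [False]) W"
    using spacer_rank_one_structure by blast
  have C_gap: "C i = map (gap W) [0..<length (C i)]" for i
    using initial_segment_decode[OF infinite_zeros[OF mc] init] .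
  have nth: "C i ! m = gap W m" if "m < length (C i)" for i m
    using C_gap[of i] that by (metis add_0 diff_zero length_map length_upt nth_map_upt)
  obtain a b where "range (gap W) = {a, b}" "a \<noteq> b"
    using minimal_complexity_card_range[OF minimal_complexity_gap[OF mc]] by (meson card_2_iff)
  then obtain m m' where m: "gap W m \<noteq> gap W m'"
    by (metis insertCI rangeE)
  \<comment> \<open>Large enough for \<open>C i\<close> to cover both positions with different
    letters.\<close>
  define i where "i = Suc (max m m')"
  have "m < length (C i)" "m' < length (C i)"
    using weave_chain(2)[of C i, OF C] by (auto simp: i_def)
  then have "gap W m \<in> set (C i)" "gap W m' \<in> set (C i)"
    using nth by (metis nth_mem)+
  moreover have "gap W k = C i ! (k mod Suc (length (C i)))" if "k mod Suc (length (C i)) < length (C i)" for k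
  proof -
    \<comment> \<open>Position \<open>k\<close> lies in a later block, which is \<open>C i\<close>
      interleaved with single letters.\<close>
    obtain as where "C (i + Suc k) = weave as (C i)"
      using weave_chain(1)[of C, OF C] by blast
    moreover have "k < length (C (i + Suc k))"
      using weave_chain(2)[of C "i + Suc k", OF C] by simp
    ultimately show ?thesis
      using nth_weave[of k as "C i"] nth[of k "i + Suc k"] that by simp
  qed
  ultimately show False
    using toeplitz_block_constant[OF minimal_complexity_gap[OF mc]] m by blast
qed

section \<open>Subshifts of recurrent words\<close>

text \<open>A return at a nonzero position is enough: it leaves room for one more letter on the left
  in the two-sided extension.\<close>

definition recurrent :: "(nat \<Rightarrow> 'a) \<Rightarrow> bool" where
  "recurrent f \<longleftrightarrow> (\<forall>i n. \<exists>j>0. map f [j..<j + n] = map f [i..<i + n])"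

lemma minimal_complexity_imp_recurrent: "minimal_complexity f \<Longrightarrow> recurrent f"
  unfolding recurrent_def using minimal_complexity_recurrent[of f 1]
  by (metis less_eq_Suc_le One_nat_def)

lemma length_decode: "length u \<le> length (decode u)"
  by (induction u) auto

text \<open>Every prefix \<open>v\<close> of the construction reappears as the second copy of
  \<open>v\<close> in the next one. Recurrence comes from the construction because \<open>W\<close>
  is not assumed to have minimal complexity.\<close>

lemma spacer_rank_one_recurrent:
  assumes "at_most_spacer_rank_construction 1 W"
  shows "recurrent W"
proof -
  obtain C where C: "\<And>i. \<exists>as. as \<noteq> [] \<and> C (Suc i) = weave as (C i)"
    and init: "\<And>i. initial_segment (decode (C i) @ [False]) W"
    using spacer_rank_one_structure assms by blast
  have "\<exists>j>0. map W [j..<j + n] = map W [i..<i + n]" for i n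
  proof -
    define v where "v = decode (C (i + n)) @ [False]"
    obtain a as where Ca: "C (Suc (i + n)) = weave (a # as) (C (i + n))"
      using C by (metis neq_Nil_conv)
    have "\<exists>r. decode (weave as (C (i + n))) @ [False] = v @ r"
      by (cases as) (auto simp: v_def)
    then obtain r where r: "decode (weave as (C (i + n))) @ [False] = v @ r" ..
    define p where "p = length v + a"
    have w: "decode (C (Suc (i + n))) @ [False] = v @ replicate a True @ v @ r"
      unfolding Ca using r by (simp add: v_def)
    have nthW: "W m = (v @ replicate a True @ v @ r) ! m" if "m < length (v @ replicate a True @ v @ r)" for m
      using init[of "Suc (i + n)"] that unfolding initial_segment_def w
      by (metis add_0 diff_zero nth_map_upt)
    have "W (p + m) = W m" if "m < length v" for m
      using nthW[of "p + m"] nthW[of m] that by (simp add: p_def nth_append)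
    moreover have "i + n < length v"
      using weave_chain(2)[of C "i + n", OF C] length_decode[of "C (i + n)"] by (simp add: v_def)
    ultimately have "map W [p + i..<p + i + n] = map W [i..<i + n]"
      by (intro nth_equalityI) (auto simp: add.assoc)
    moreover have "p + i > 0"
      by (simp add: p_def v_def)
    ultimately show ?thesis by blast
  qed
  then show ?thesis
    unfolding recurrent_def by blast
qed

text \<open>An occurrence of \<open>u\<close> is enlarged by one letter on each side per stage,
  after moving to a place where the current window recurs. The windows around \<open>p k\<close>
  converge to a two-sided word.\<close>

lemma recurrent_factor_in_subshift:
  assumes "recurrent V" "factor u V"
  shows "\<exists>x\<in>subshift_of V. subword u x"
proof -
  define n where "n = length u"
  have "\<exists>p. \<forall>k. (k \<le> p k \<and> (k = 0 \<longrightarrow> u = map V [p k..<p k + n])) \<and>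
      map V [p (Suc k) - k..<p (Suc k) - k + (n + 2 * k)] = map V [p k - k..<p k - k + (n + 2 * k)]"
  proof (rule dependent_nat_choice)
    show "\<exists>p. 0 \<le> p \<and> ((0::nat) = 0 \<longrightarrow> u = map V [p..<p + n])"
      using assms(2) by (simp add: factor_def n_def)
  next
    fix p k :: nat
    assume "k \<le> p \<and> (k = 0 \<longrightarrow> u = map V [p..<p + n])"
    obtain j where "j > 0" "map V [j..<j + (n + 2 * k)] = map V [p - k..<p - k + (n + 2 * k)]"
      using assms(1) unfolding recurrent_def by blast
    then show "\<exists>p'. (Suc k \<le> p' \<and> (Suc k = 0 \<longrightarrow> u = map V [p'..<p' + n])) \<and>
      map V [p' - k..<p' - k + (n + 2 * k)] = map V [p - k..<p - k + (n + 2 * k)]"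
      \<comment> \<open>As \<open>j > 0\<close>, the new centre is at least
        \<open>Suc k\<close>.\<close>
      by (intro exI[of _ "j + k"]) simp
  qed
  then obtain p where p: "\<And>k. k \<le> p k" "u = map V [p 0..<p 0 + n]"
    "\<And>k. map V [p (Suc k) - k..<p (Suc k) - k + (n + 2 * k)] = map V [p k - k..<p k - k + (n + 2 * k)]"
    by blast
  have agree: "V (nat (int (p (Suc k)) + z)) = V (nat (int (p k) + z))"
    if "- int k \<le> z" "z < int n + int k" for k z
  proof -
    define t where "t = nat (z + int k)"
    have t: "t < n + 2 * k" using that by (simp add: t_def)
    have "V (p (Suc k) - k + t) = V (p k - k + t)"
      using arg_cong[OF p(3)[of k], of "\<lambda>w. w ! t"] t by simp
    moreover have "nat (int (p (Suc k)) + z) = p (Suc k) - k + t" "nat (int (p k) + z) = p k - k + t"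
      using that p(1)[of k] p(1)[of "Suc k"] by (auto simp: t_def)
    ultimately show ?thesis by simp
  qed
  have stable: "V (nat (int (p K) + z)) = V (nat (int (p k) + z))"
    if "- int k \<le> z" "z < int n + int k" "k \<le> K" for k K z
    using that(3)
  proof (induction K rule: dec_induct)
    case (step K)
    have "- int K \<le> z" "z < int n + int K"
      using step(1) \<open>- int k \<le> z\<close> \<open>z < int n + int k\<close> by linarith+
    from trans[OF agree[OF this] step(3)] show ?case .
  qed simp
  \<comment> \<open>The level is large enough for coordinate \<open>z\<close> to lie in the part of
    the window that no longer changes.\<close>
  define x where "x z = V (nat (int (p (Suc (nat \<bar>z\<bar>))) + z))" for z
  have x: "x z = V (nat (int (p K) + z))" if "nat \<bar>z\<bar> < K" for z K
    unfolding x_def using that by (intro stable[symmetric]) auto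
  have "subword w V" if sub: "subword w x" for w
  proof -
    obtain m where m: "w = map (\<lambda>j. x (m + int j)) [0..<length w]"
      using sub unfolding subword_def by blast
    \<comment> \<open>All coordinates of the occurrence of \<open>w\<close> are below
      \<open>K\<close> in absolute value, so \<open>w\<close> can be read in \<open>V\<close> around
      \<open>p K\<close>.\<close>
    define K where "K = Suc (nat \<bar>m\<bar> + length w)"
    have "w = map (\<lambda>j. V (nat (int (p K) + m) + j)) [0..<length w]"
    proof (subst m, rule map_cong[OF refl])
      fix j assume j: "j \<in> set [0..<length w]"
      then have "x (m + int j) = V (nat (int (p K) + (m + int j)))"
        by (intro x) (auto simp: K_def)
      also have "nat (int (p K) + (m + int j)) = nat (int (p K) + m) + j"
        using p(1)[of K] by (simp add: K_def nat_add_distrib flip: add.assoc)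
      finally show "x (m + int j) = V (nat (int (p K) + m) + j)" .
    qed
    then show ?thesis
      unfolding subword_def of_nat_id by blast
  qed
  moreover have "subword u x"
  proof -
    have "x (0 + int j) = V (p 0 + j)" if "j < n" for j
      unfolding x_def using stable[of 0 "int j" "Suc (nat \<bar>0 + int j\<bar>)"] that by (simp flip: of_nat_add)
    then have "map V [p 0..<p 0 + n] = map (\<lambda>j. x (0 + int j)) [0..<n]"
      by (intro nth_equalityI) auto
    from trans[OF p(2) this] have "u = map (\<lambda>j. x (0 + int j)) [0..<length u]"
      unfolding n_def .
    then show ?thesis
      unfolding subword_def by blast
  qed
  ultimately show ?thesis
    unfolding subshift_of_def by blast
qed

lemma subshift_of_eq_imp_factor:
  assumes "recurrent V" "subshift_of V = subshift_of W" "factor u V"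
  shows "factor u W"
  using recurrent_factor_in_subshift[OF assms(1,3)] assms(2)
  by (auto simp: subshift_of_def subword_iff_factor)

lemma subshift_subshift_of: "subshift (subshift_of V)"
proof -
  have "closed (subshift_of V)"
  proof -
    have op: "open {x :: int \<Rightarrow> bool. x k = b}" for k b
      using open_vimage[OF open_discrete[of "{b}"] continuous_on_product_coordinates[of k]]
      by (simp add: vimage_def)
    \<comment> \<open>The complement is a union of cylinders, each fixing an occurrence of a
      forbidden word.\<close>
    have "- subshift_of V = (\<Union>u\<in>{u. \<not> subword u V}. \<Union>m. \<Inter>j\<in>{..<length u}. {x. x (m + int j) = u ! j})"
    proof -
      have "u = map g [0..<length u] \<longleftrightarrow> (\<forall>j<length u. g j = u ! j)" for u :: "bool list" and g
        using list_eq_iff_nth_eq[of u "map g [0..<length u]"] by auto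
      then have sw: "subword u x \<longleftrightarrow> (\<exists>m. \<forall>j<length u. x (m + int j) = u ! j)" for u and x :: "int \<Rightarrow> bool"
        unfolding subword_def by simp
      show ?thesis
        unfolding subshift_of_def sw by blast
    qed
    also have "open \<dots>"
      using op by (intro open_UN ballI open_INT) auto
    finally show ?thesis
      by (simp add: closed_def)
  qed
  moreover have "shift x \<in> subshift_of V" if "x \<in> subshift_of V" for x
  proof -
    have "subword u x" if sub: "subword u (shift x)" for u
    proof -
      obtain m where "u = map (\<lambda>j. shift x (m + int j)) [0..<length u]"
        using sub unfolding subword_def by blast
      then have "u = map (\<lambda>j. x ((m + 1) + int j)) [0..<length u]"
        unfolding shift_def by (simp add: algebra_simps)
      then show ?thesis unfolding subword_def by blast
    qed
    then show ?thesis using that by (auto simp: subshift_of_def)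
  qed
  moreover have "x \<in> shift ` subshift_of V" if "x \<in> subshift_of V" for x
  proof -
    define y where "y i = x (i - 1)" for i
    have "subword u x" if sub: "subword u y" for u
    proof -
      obtain m where "u = map (\<lambda>j. y (m + int j)) [0..<length u]"
        using sub unfolding subword_def by blast
      then have "u = map (\<lambda>j. x ((m - 1) + int j)) [0..<length u]"
        unfolding y_def by (simp add: algebra_simps)
      then show ?thesis unfolding subword_def by blast
    qed
    then have "y \<in> subshift_of V"
      using that by (auto simp: subshift_of_def)
    moreover have "x = shift y"
      by (simp add: shift_def y_def)
    ultimately show ?thesis by blast
  qed
  ultimately show ?thesis
    unfolding subshift_def by blast
qed

section \<open>Rank-two constructions\<close>

text \<open>The substitution that sends 0 to 0 1^c and 1 to 0 1^d.\<close>

definition zero_blocks :: "nat \<Rightarrow> nat \<Rightarrow> bool list \<Rightarrow> bool list" where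
  "zero_blocks c d u = concat (map (\<lambda>b. False # replicate (if b then d else c) True) u)"

text \<open>Here \<open>c\<close> is the gap that never occurs twice in a row, whichever of the two
  values that is, and \<open>y'\<close> is the gap word with \<open>c\<close> renamed to
  \<open>False\<close>. If \<open>y\<close> has no adjacent zeros, no gap is 0.\<close>

lemma desubstitution:
  assumes mc: "minimal_complexity y"
  obtains c d y' where "d = Suc c \<or> c = Suc d" "minimal_complexity y'" "\<not> factor [False, False] y'"
    "\<And>u. factor u y' \<Longrightarrow> factor (zero_blocks c d u) y"
    "\<not> factor [False, False] y \<Longrightarrow> c > 0 \<and> d > 0"
proof -
  note inf = infinite_zeros[OF mc]
  obtain a where a: "range (gap y) = {a, Suc a}"
    using gap_values[OF mc] .
  have "\<exists>c d. range (gap y) = {c, d} \<and> (d = Suc c \<or> c = Suc d) \<and> \<not> factor [c, c] (gap y)"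
    using isolated_letter[OF minimal_complexity_gap[OF mc] a] a by (metis insert_commute n_not_Suc_n)
  then obtain c d where cd: "range (gap y) = {c, d}" "d = Suc c \<or> c = Suc d" "\<not> factor [c, c] (gap y)"
    by blast
  define y' where "y' = (\<lambda>k. k \<noteq> c) \<circ> gap y"
  have "minimal_complexity y'"
    unfolding y'_def using cd by (intro minimal_complexity_comp minimal_complexity_gap mc) (auto simp: inj_on_def)
  moreover have "\<not> factor [False, False] y'"
    using cd(3) by (auto simp: factor_two_letters y'_def)
  moreover have "factor (zero_blocks c d u) y" if "factor u y'" for u
  proof -
    obtain i where i: "u = map y' [i..<i + length u]"
      using \<open>factor u y'\<close> unfolding factor_def by blast
    define w where "w = map (gap y) [i..<i + length u]"
    have "u = map (\<lambda>k. k \<noteq> c) w"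
      using i by (simp add: w_def y'_def)
    moreover have "set w \<subseteq> {c, d}"
      using cd(1) by (auto simp: w_def)
    ultimately have "zero_blocks c d u = decode w"
      unfolding zero_blocks_def decode_def by (auto intro!: arg_cong[of _ _ concat])
    moreover have "factor (decode w @ [False]) y"
      by (rule factor_decode[OF inf]) (simp add: w_def)
    ultimately show ?thesis
      using factor_sublist by (metis sublist_append_rightI)
  qed
  moreover have "k > 0" if "\<not> factor [False, False] y" "k \<in> {c, d}" for k
  proof (rule ccontr)
    assume "\<not> k > 0"
    moreover have "factor [k] (gap y)"
      using that(2) cd(1) by (auto simp: factor_def)
    ultimately have "factor (decode [0] @ [False]) y"
      using factor_decode[OF inf, of "[k]"] by simp
    with that(1) show False by simp
  qed
  ultimately show thesis
    using that[of d c y'] cd(2) by blast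
qed

text \<open>
  At level 0 an exponent may be 0. From level 1 on the letter \<^term>\<open>False\<close> is isolated, so both
  exponents are positive and both new words are built from at least two old ones, as
  \<^const>\<open>built_from\<close> requires.
\<close>

primrec iterate_blocks :: "(nat \<Rightarrow> nat) \<Rightarrow> (nat \<Rightarrow> nat) \<Rightarrow> nat \<Rightarrow> bool \<Rightarrow> bool list" where
  "iterate_blocks c d 0 b = [b]"
| "iterate_blocks c d (Suc n) b =
    concat (map (iterate_blocks c d n) (False # replicate (if b then d n else c n) True))"

lemma concat_iterate_blocks_Suc:
  "concat (map (iterate_blocks c d (Suc n)) u) =
    concat (map (iterate_blocks c d n) (zero_blocks (c n) (d n) u))"
  by (induction u) (auto simp: zero_blocks_def)

text \<open>Iterated desubstitution gives words \<open>y n\<close> with \<open>y 0 = V\<close>; the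
  composed substitutions carry factors of \<open>y n\<close> back to factors of
  \<open>V\<close>.\<close>

lemma minimal_complexity_directive:
  assumes mc: "minimal_complexity V"
  shows "\<exists>c d. \<forall>n. (d n = Suc (c n) \<or> c n = Suc (d n)) \<and> (n > 0 \<longrightarrow> c n > 0 \<and> d n > 0) \<and>
    factor (iterate_blocks c d n False) V"
proof -
  define P where "P n y \<longleftrightarrow> minimal_complexity y \<and> (n = 0 \<longrightarrow> y = V) \<and>
    (n > 0 \<longrightarrow> \<not> factor [False, False] y)" for n :: nat and y
  define Q where "Q n y y' \<longleftrightarrow> (\<exists>c d. (d = Suc c \<or> c = Suc d) \<and> (n > 0 \<longrightarrow> c > 0 \<and> d > 0) \<and>
    (\<forall>u. factor u y' \<longrightarrow> factor (zero_blocks c d u) y))" for n :: nat and y y'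
  have "\<exists>y. \<forall>n. P n (y n) \<and> Q n (y n) (y (Suc n))"
  proof (rule dependent_nat_choice)
    show "\<exists>y. P 0 y"
      using mc by (simp add: P_def)
  next
    fix y n assume y: "P n y"
    then have "minimal_complexity y"
      by (simp add: P_def)
    then obtain c d y' where y': "d = Suc c \<or> c = Suc d" "minimal_complexity y'" "\<not> factor [False, False] y'"
      "\<And>u. factor u y' \<Longrightarrow> factor (zero_blocks c d u) y"
      "\<not> factor [False, False] y \<Longrightarrow> c > 0 \<and> d > 0"
      using desubstitution by metis
    have "Q n y y'"
      unfolding Q_def using y y' by (intro exI[of _ c] exI[of _ d]) (simp add: P_def)
    moreover have "P (Suc n) y'"
      using y' by (simp add: P_def)
    ultimately show "\<exists>y'. P (Suc n) y' \<and> Q n y y'" by blast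
  qed
  then obtain y where PQ: "\<And>n. P n (y n)" "\<And>n. Q n (y n) (y (Suc n))"
    by blast
  have y: "\<And>n. minimal_complexity (y n)" "y 0 = V"
    using PQ(1) by (simp_all add: P_def)
  obtain c d where cd: "\<And>n. d n = Suc (c n) \<or> c n = Suc (d n)" "\<And>n. n > 0 \<Longrightarrow> c n > 0 \<and> d n > 0"
    "\<And>n u. factor u (y (Suc n)) \<Longrightarrow> factor (zero_blocks (c n) (d n) u) (y n)"
    using PQ(2) unfolding Q_def by metis
  have "factor u (y n) \<Longrightarrow> factor (concat (map (iterate_blocks c d n) u)) V" for n u
  proof (induction n arbitrary: u)
    case 0
    then show ?case using y(2) by simp
  next
    case (Suc n)
    then show ?case
      using cd(3) concat_iterate_blocks_Suc[of c d n u] by metis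
  qed
  moreover have "factor [False] (y n)" for n
  proof -
    obtain m where "\<not> y n m"
      using infinite_zeros[OF y(1)[of n]] by (metis (mono_tags) Collect_empty_eq finite.emptyI)
    then show ?thesis
      by (auto simp: factor_def intro: exI[of _ m])
  qed
  ultimately have "factor (concat (map (iterate_blocks c d n) [False])) V" for n
    by blast
  then have "factor (iterate_blocks c d n False) V" for n by simp
  then show ?thesis
    using cd(1,2) by blast
qed

lemma prefix_chain_limit:
  assumes chain: "\<And>n. prefix (p n) (p (Suc n))" and len: "\<And>n. n < length (p n)"
  shows "\<exists>W. \<forall>n. initial_segment (p n) W"
proof -
  \<comment> \<open>The diagonal is defined because \<open>p m\<close> is longer than
    \<open>m\<close>.\<close>
  define W where "W m = p m ! m" for m
  have pre: "prefix (p i) (p j)" if "i \<le> j" for i j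
    using that by (induction j rule: dec_induct) (use chain prefix_order.order_trans in blast)+
  have "p n ! m = W m" if "m < length (p n)" for n m
    using pre[of n m] pre[of m n] len[of m] that unfolding W_def prefix_def
    by (metis linorder_linear nth_append)
  then have "p n = map W [0..<length (p n)]" for n
    by (intro nth_equalityI) auto
  then show ?thesis
    unfolding initial_segment_def by blast
qed

text \<open>Suffixes of long right special factors are right special, so the complexity of
  \<open>W\<close> grows at every length and is at least \<open>n + 1\<close>. Its factors then
  exhaust those of \<open>V\<close>.\<close>

lemma minimal_complexity_if_right_special:
  assumes V: "minimal_complexity V" and sub: "\<And>u. factor u W \<Longrightarrow> factor u V"
    and special: "\<And>n. \<exists>r a b. n \<le> length r \<and> a \<noteq> b \<and> factor (r @ [a]) W \<and> factor (r @ [b]) W"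
  shows "factors W = factors V"
proof
  fix n
  have subs: "factors W k \<subseteq> factors V k" for k
    using sub by (auto simp: factors_def)
  then have fin: "finite (factors W k)" for k
    using minimal_complexity_finite[OF V] finite_subset by blast
  have "card (factors W k) \<ge> k + 1" for k
  proof (induction k)
    case (Suc k)
    obtain r a b where r: "k \<le> length r" "a \<noteq> b" "factor (r @ [a]) W" "factor (r @ [b]) W"
      using special by blast
    define s where "s = drop (length r - k) r"
    have "sublist (s @ [x]) (r @ [x])" for x
      unfolding sublist_def s_def by (intro exI[of _ "take (length r - k) r"] exI[of _ "[]"]) simp
    then have "s @ [a] \<in> factors W (Suc k)" "s @ [b] \<in> factors W (Suc k)"
      using r factor_sublist by (fastforce simp: factors_def s_def)+
    then have "\<not> inj_on butlast (factors W (Suc k))"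
      using r(2) by (metis butlast_snoc inj_on_contraD last_snoc)
    then have "card (factors W k) < card (factors W (Suc k))"
      using butlast_factors[of W k] card_image_le[OF fin, of butlast "Suc k"] eq_card_imp_inj_on[OF fin, of butlast "Suc k"]
      by fastforce
    with Suc show ?case by simp
  qed (simp add: factors_0)
  then have "card (factors V n) \<le> card (factors W n)"
    using V by (simp add: minimal_complexity_def)
  then show "factors W n = factors V n"
    using card_seteq[OF minimal_complexity_finite[OF V] subs] by blast
qed

lemma initial_segment_prefix:
  assumes "initial_segment w W" "prefix u w"
  shows "initial_segment u W"
proof -
  obtain z where z: "w = u @ z"
    using assms(2) by (auto simp: prefix_def)
  have "u = take (length u) w"
    using z by simp
  also have "\<dots> = take (length u) (map W [0..<length w])"
    using assms(1) unfolding initial_segment_def by (rule arg_cong)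
  also have "\<dots> = map W [0..<length u]"
    using z by (simp add: take_map)
  finally show ?thesis
    unfolding initial_segment_def .
qed

section \<open>Deletion of trailing ones\<close>

definition strip_ones :: "bool list \<Rightarrow> bool list" where
  "strip_ones w = rev (dropWhile id (rev w))"

lemma strip_ones_append: "False \<in> set w \<Longrightarrow> strip_ones (u @ w) = u @ strip_ones w"
  by (simp add: strip_ones_def dropWhile_append1)

lemma strip_ones_decomp: "w = strip_ones w @ replicate (length w - length (strip_ones w)) True"
proof -
  have "takeWhile id (rev w) = replicate (length (takeWhile id (rev w))) True"
    by (intro replicate_length_same[symmetric]) (auto dest: set_takeWhileD)
  moreover have "w = strip_ones w @ rev (takeWhile id (rev w))"
    unfolding strip_ones_def by (metis rev_append rev_rev_ident takeWhile_dropWhile_id)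
  ultimately show ?thesis
    by (metis add_diff_cancel_left' length_append length_rev rev_replicate)
qed

lemma strip_ones_zero_bounded:
  assumes "w \<noteq> []" "\<not> hd w"
  shows "strip_ones w \<in> zero_bounded_words"
proof -
  have "False \<in> set w"
    using assms by (metis (full_types) hd_in_set)
  then have ne: "dropWhile id (rev w) \<noteq> []"
    by (auto simp: dropWhile_eq_Nil_conv)
  then have "\<not> hd (dropWhile id (rev w))"
    using hd_dropWhile[OF ne] by simp
  moreover have "hd (strip_ones w) = hd w"
    using ne strip_ones_decomp[of w] by (metis hd_append2 rev_is_Nil_conv strip_ones_def)
  ultimately show ?thesis
    using ne assms(2) by (simp add: zero_bounded_words_def strip_ones_def last_rev)
qed

text \<open>The ones deleted from each word of \<open>L\<close> but the last become the spacer after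
  it. Spaced words are indexed from 1, hence the shift by one in \<open>v\<close> and
  \<open>a\<close>.\<close>

lemma strip_ones_concat_built:
  assumes "length L \<ge> 2" "\<And>w. w \<in> set L \<Longrightarrow> False \<in> set w" "strip_ones ` set L \<subseteq> S"
  shows "built_from_starting_with S (strip_ones (hd L)) (strip_ones (concat L))"
proof -
  define k where "k = length L - 1"
  define v where "v i = strip_ones (L ! (i - 1))" for i
  define a where "a i = length (L ! (i - 1)) - length (v i)" for i
  have L: "length L = k + 1" "L \<noteq> []"
    using assms(1) by (auto simp: k_def)
  have "map (\<lambda>i. v i @ replicate (a i) True) [1..<k + 1] = butlast L"
    unfolding v_def a_def using L(1) by (intro nth_equalityI) (auto simp: nth_butlast strip_ones_decomp[symmetric] simp del: upt_Suc)
  moreover have "v (k + 1) = strip_ones (last L)"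
    using L by (simp add: v_def last_conv_nth)
  ultimately have "spaced_word k v a = concat (butlast L) @ strip_ones (last L)"
    by (simp add: spaced_word_def)
  also have "\<dots> = strip_ones (concat (butlast L) @ last L)"
    using assms(2) L(2) by (simp add: strip_ones_append)
  also have "concat (butlast L) @ last L = concat L"
    using L(2) by (metis append_butlast_last_id append_Nil2 concat.simps concat_append)
  finally have "strip_ones (concat L) = spaced_word k v a"
    by (rule sym)
  moreover have "v i \<in> S" if "i \<in> {1..k + 1}" for i
    using that assms(3) L(1) by (auto simp: v_def intro!: subsetD[OF assms(3)])
  moreover have "v 1 = strip_ones (hd L)"
    using L(2) by (simp add: v_def hd_conv_nth)
  moreover have "k \<ge> 1"
    using assms(1) by (simp add: k_def)
  ultimately show ?thesis
    unfolding built_from_starting_with_def by blast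
qed

lemma built_from_starting_with_imp_built_from: "built_from_starting_with S u w \<Longrightarrow> built_from S w"
  by (auto simp: built_from_starting_with_def built_from_def)

section \<open>The limit of the iterated substitutions\<close>

context
  fixes c d :: "nat \<Rightarrow> nat"
  assumes consecutive: "\<And>n. d n = Suc (c n) \<or> c n = Suc (d n)"
    and positive: "\<And>n. n > 0 \<Longrightarrow> c n > 0 \<and> d n > 0"
begin

text \<open>The pair (X, Y) of level \<open>n\<close> is \<open>\<Phi> n False\<close>,
  \<open>\<Phi> n True\<close>.\<close>

abbreviation "\<Phi> \<equiv> iterate_blocks c d"

lemma iterate_blocks_hd: "n > 0 \<or> \<not> b \<Longrightarrow> \<Phi> n b \<noteq> [] \<and> \<not> hd (\<Phi> n b)"
proof (induction n arbitrary: b)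
  case (Suc n)
  then show ?case
    using Suc.IH[of False] by (simp add: hd_append)
qed auto

lemma iterate_blocks_False_in_set: "n > 0 \<or> \<not> b \<Longrightarrow> False \<in> set (\<Phi> n b)"
  using iterate_blocks_hd by (metis (full_types) hd_in_set)

lemma iterate_blocks_nonempty: "\<Phi> n b \<noteq> []"
  using iterate_blocks_hd[of n b] by (cases n) auto

lemma iterate_blocks_FT_prefix:
  assumes "n > 0"
  obtains r where "\<Phi> (Suc n) False = \<Phi> n False @ \<Phi> n True @ r"
  using positive[OF assms] by (cases "c n") auto

lemma iterate_blocks_length: "n < length (\<Phi> (Suc n) False)"
proof (induction n)
  case (Suc n)
  obtain r where "\<Phi> (Suc (Suc n)) False = \<Phi> (Suc n) False @ \<Phi> (Suc n) True @ r"
    using iterate_blocks_FT_prefix[of "Suc n"] by blast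
  with Suc iterate_blocks_nonempty[of "Suc n" True] show ?case
    by (cases "\<Phi> (Suc n) True") (auto simp del: iterate_blocks.simps)
qed simp

lemma concat_replicate_commute: "concat (replicate k w) @ w = w @ concat (replicate k w)"
  by (induction k) auto

text \<open>With \<open>k = min (c n) (d n)\<close>, the two products of the next level are X Y^k (X
  Y) Y^k and X Y^k (Y X) Y^k in some order, so the common prefix grows by at least the length of
  X.\<close>

lemma iterate_blocks_mismatch:
  "\<exists>r a b s t. n \<le> length r \<and> a \<noteq> b \<and> \<Phi> n False @ \<Phi> n True = r @ a # s \<and>
    \<Phi> n True @ \<Phi> n False = r @ b # t"
proof (induction n)
  case 0
  show ?case by (intro exI[of _ "[]"]) auto
next
  case (Suc n)
  let ?X = "\<Phi> n False" and ?Y = "\<Phi> n True"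
  define P where "P k = concat (replicate k ?Y)" for k
  have P: "P (Suc k) = ?Y @ P k" "P (Suc k) = P k @ ?Y" for k
    by (auto simp: P_def concat_replicate_commute)
  have XY: "\<Phi> (Suc n) False = ?X @ P (c n)" "\<Phi> (Suc n) True = ?X @ P (d n)"
    by (auto simp: P_def)
  obtain r a b s t where r: "n \<le> length r" "a \<noteq> b" "?X @ ?Y = r @ a # s" "?Y @ ?X = r @ b # t"
    using Suc by blast
  define k where "k = min (c n) (d n)"
  have 1: "(?X @ P k) @ (?X @ P (Suc k)) = (?X @ P k @ r) @ a # s @ P k"
    using r(3) by (simp add: P(1))
  have 2: "(?X @ P (Suc k)) @ (?X @ P k) = (?X @ P k @ r) @ b # t @ P k"
    using r(4) by (simp add: P(2))
  have len: "Suc n \<le> length (?X @ P k @ r)"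
    using r(1) iterate_blocks_nonempty[of n False] by (cases ?X) auto
  show ?case
  proof (cases "d n = Suc (c n)")
    case True
    then have "k = c n" by (simp add: k_def)
    then show ?thesis
      unfolding XY using True 1 2 len r(2) by metis
  next
    case False
    then have "c n = Suc (d n)" "k = d n"
      using consecutive[of n] by (auto simp: k_def)
    then show ?thesis
      unfolding XY using 1 2 len r(2) by metis
  qed
qed

text \<open>The next X ends in Y, the next Y begins with X, and the two are adjacent one level
  higher.\<close>

lemma iterate_blocks_TF_sublist:
  assumes "n > 0"
  shows "sublist (\<Phi> n True @ \<Phi> n False) (\<Phi> (Suc (Suc n)) False)"
proof -
  obtain k where "c n = Suc k"
    using positive[OF assms] by (cases "c n") auto
  then have "\<Phi> (Suc n) False = \<Phi> n False @ concat (replicate k (\<Phi> n True)) @ \<Phi> n True"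
    using concat_replicate_commute[of k "\<Phi> n True"] by simp
  moreover obtain r where "\<Phi> (Suc n) True = \<Phi> n False @ r"
    by simp
  moreover obtain r' where "\<Phi> (Suc (Suc n)) False = \<Phi> (Suc n) False @ \<Phi> (Suc n) True @ r'"
    using iterate_blocks_FT_prefix[of "Suc n"] by blast
  ultimately have "\<Phi> (Suc (Suc n)) False =
      (\<Phi> n False @ concat (replicate k (\<Phi> n True))) @ (\<Phi> n True @ \<Phi> n False) @ (r @ r')"
    by (simp del: iterate_blocks.simps)
  then show ?thesis
    unfolding sublist_def by blast
qed

lemma iterate_blocks_limit: "\<exists>W. \<forall>n. initial_segment (\<Phi> (Suc n) False) W"
proof -
  have "prefix (\<Phi> (Suc n) False) (\<Phi> (Suc (Suc n)) False)" for n
    using iterate_blocks_FT_prefix[of "Suc n"] by (metis prefixI zero_less_Suc)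
  then show ?thesis
    using prefix_chain_limit[of "\<lambda>n. \<Phi> (Suc n) False"] iterate_blocks_length by blast
qed

text \<open>Both X Y and Y X occur in \<open>W\<close>; their longest common prefix is right
  special.\<close>

lemma limit_right_special:
  assumes W: "\<And>n. initial_segment (\<Phi> (Suc n) False) W"
  shows "\<exists>r a b. n \<le> length r \<and> a \<noteq> b \<and> factor (r @ [a]) W \<and> factor (r @ [b]) W"
proof -
  have fac: "factor u W" if "sublist u (\<Phi> (Suc k) False)" for u k
    using factor_sublist[OF _ that] W[of k] unfolding initial_segment_def by (metis factor_map_upt)
  obtain r a b s t where r: "Suc n \<le> length r" "a \<noteq> b" "\<Phi> (Suc n) False @ \<Phi> (Suc n) True = r @ a # s"
    "\<Phi> (Suc n) True @ \<Phi> (Suc n) False = r @ b # t"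
    using iterate_blocks_mismatch[of "Suc n"] by blast
  obtain e where "\<Phi> (Suc (Suc n)) False = \<Phi> (Suc n) False @ \<Phi> (Suc n) True @ e"
    using iterate_blocks_FT_prefix[of "Suc n"] by blast
  then have "\<Phi> (Suc (Suc n)) False = [] @ (r @ [a]) @ (s @ e)"
    using r(3) by simp
  then have "factor (r @ [a]) W"
    using fac[of "r @ [a]" "Suc n"] unfolding sublist_def by blast
  moreover have "sublist (r @ [b]) (\<Phi> (Suc n) True @ \<Phi> (Suc n) False)"
    unfolding r(4) sublist_def by (intro exI[of _ "[]"] exI[of _ t]) simp
  then have "factor (r @ [b]) W"
    using fac iterate_blocks_TF_sublist[of "Suc n"] sublist_order.order_trans by blast
  ultimately show ?thesis
    using r(1,2) by (intro exI[of _ r] exI[of _ a] exI[of _ b]) simp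
qed

lemma limit_spacer_rank_two:
  assumes W: "\<And>n. initial_segment (\<Phi> (Suc n) False) W"
  shows "at_most_spacer_rank_construction 2 W"
proof -
  \<comment> \<open>Starting one level up makes the exponents positive; at level 1 both words are a
    zero followed by ones and reduce to \<open>[False]\<close>, as \<open>v 0\<close> must.\<close>
  define v where "v i j = strip_ones (\<Phi> (Suc i) (j = (2::nat)))" for i j
  have img: "v i ` {1..2} = {strip_ones (\<Phi> (Suc i) False), strip_ones (\<Phi> (Suc i) True)}" for i
  proof -
    have "{1..2::nat} = {1, 2}" by auto
    then show ?thesis by (simp add: v_def)
  qed
  have built: "built_from_starting_with (v i ` {1..2}) (v i 1) (v (i + 1) j)" for i j
  proof -
    let ?L = "map (\<Phi> (Suc i)) (False # replicate (if j = 2 then d (Suc i) else c (Suc i)) True)"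
    have "built_from_starting_with (v i ` {1..2}) (strip_ones (hd ?L)) (strip_ones (concat ?L))"
    proof (rule strip_ones_concat_built)
      show "length ?L \<ge> 2"
        using positive[of "Suc i"] by simp
      show "False \<in> set w" if "w \<in> set ?L" for w
        using that iterate_blocks_False_in_set[of "Suc i"] by (auto simp del: iterate_blocks.simps)
      show "strip_ones ` set ?L \<subseteq> v i ` {1..2}"
        unfolding img by (auto simp del: iterate_blocks.simps)
    qed
    then show ?thesis
      by (simp add: v_def)
  qed
  have v0: "v 0 j = [False]" for j
  proof -
    have "concat (map (\<Phi> 0) u) = u" for u
      by (induction u) auto
    then have "v 0 j = strip_ones (False # replicate (if j = 2 then d 0 else c 0) True)"
      unfolding v_def iterate_blocks.simps(2) by simp
    moreover have "dropWhile id (replicate k True @ [False]) = [False]" for k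
      by (induction k) auto
    ultimately show ?thesis
      by (simp add: strip_ones_def)
  qed
  have zb: "v i ` {1..2} \<subseteq> zero_bounded_words" for i
    unfolding img using strip_ones_zero_bounded iterate_blocks_hd[of "Suc i"] by blast
  have init: "initial_segment (v i 1) W" for i
  proof (rule initial_segment_prefix[OF W])
    show "prefix (v i 1) (\<Phi> (Suc i) False)"
      using strip_ones_decomp[of "\<Phi> (Suc i) False"] unfolding v_def
      by (metis prefixI numeral_eq_one_iff semiring_norm(85))
  qed
  have built': "built_from (v i ` {1..2}) (v (i + 1) j)" for i j
    using built_from_starting_with_imp_built_from[OF built] .
  show ?thesis
    unfolding at_most_spacer_rank_construction_def
  proof (intro exI[of _ "\<lambda>_. 2"] exI[of _ v] conjI allI ballI)
    show "v i ` {1..2} \<subseteq> zero_bounded_words" for i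
      by (rule zb)
    show "v 0 j = [False]" for j
      by (rule v0)
    show "built_from_starting_with (v i ` {1..2}) (v i 1) (v (i + 1) 1)" for i
      by (rule built)
    show "built_from (v i ` {1..2}) (v (i + 1) j)" for i j
      by (rule built')
    show "initial_segment (v i 1) W" for i
      by (rule init)
  qed simp_all
qed

end

section \<open>Sturmian words and their subshifts\<close>

lemma sturmian_iff_minimal_complexity: "sturmian V \<longleftrightarrow> minimal_complexity V"
  by (simp add: sturmian_def minimal_complexity_def factors_def subword_iff_factor)

theorem corollary5p6:
  fixes V :: "nat \<Rightarrow> bool"
  assumes "sturmian V"
  shows "spacer_rank_two_system (subshift_of V)"
proof -
  have V: "minimal_complexity V"
    using assms by (simp add: sturmian_iff_minimal_complexity)
  obtain c d where cd: "\<And>n. d n = Suc (c n) \<or> c n = Suc (d n)" "\<And>n. n > 0 \<Longrightarrow> c n > 0 \<and> d n > 0"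
    "\<And>n. factor (iterate_blocks c d n False) V"
    using minimal_complexity_directive[OF V] by blast
  obtain W where W: "\<And>n. initial_segment (iterate_blocks c d (Suc n) False) W"
    using iterate_blocks_limit[of d c, OF cd(1,2)] by blast
  have "factor u V" if u: "factor u W" for u
  proof -
    obtain i where i: "u = map W [i..<i + length u]"
      using u unfolding factor_def by blast
    \<comment> \<open>The occurrence of \<open>u\<close> ends at \<open>n\<close>, within the prefix
      of level \<open>Suc n\<close>.\<close>
    define n where "n = i + length u"
    let ?w = "iterate_blocks c d (Suc n) False"
    have "n \<le> length ?w"
      using iterate_blocks_length[of d c, OF cd(1,2), of n] by simp
    have "drop i (take n ?w) = drop i (take n (map W [0..<length ?w]))"
      using W[of n] unfolding initial_segment_def by (rule arg_cong)
    also have "\<dots> = map W [i..<n]"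
      using \<open>n \<le> length ?w\<close> by (simp add: take_map drop_map del: iterate_blocks.simps)
    also have "\<dots> = u"
      using i unfolding n_def by (rule sym)
    finally have "sublist u ?w"
      by (metis sublist_drop sublist_take sublist_order.order_trans)
    then show ?thesis
      using cd(3) factor_sublist by blast
  qed
  then have eq: "factors W = factors V"
    using minimal_complexity_if_right_special[OF V] limit_right_special[of d c, OF cd(1,2) W] by blast
  then have "factor u W \<longleftrightarrow> factor u V" for u
    by (metis (mono_tags, lifting) factors_def mem_Collect_eq)
  then have "subshift_of V = subshift_of W"
    by (simp add: subshift_of_def subword_iff_factor)
  moreover have "minimal_complexity W"
    using V eq by (simp add: minimal_complexity_def)
  then have "spacer_rank_two_construction W"
    using minimal_complexity_not_spacer_rank_one limit_spacer_rank_two[of d c, OF cd(1,2) W]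
    by (simp add: spacer_rank_two_construction_def)
  moreover have False if W': "spacer_rank_one_construction W'" "subshift_of V = subshift_of W'" for W'
  proof -
    have rank: "at_most_spacer_rank_construction 1 W'"
      using W'(1) by (simp add: spacer_rank_one_construction_def)
    \<comment> \<open>Recurrence of both words makes the common subshift determine their factors, so
      \<open>W'\<close> inherits minimal complexity.\<close>
    have "factor u V \<longleftrightarrow> factor u W'" for u
      using subshift_of_eq_imp_factor[OF minimal_complexity_imp_recurrent[OF V] W'(2)]
        subshift_of_eq_imp_factor[OF spacer_rank_one_recurrent[OF rank] W'(2)[symmetric]] by blast
    then have "minimal_complexity W'"
      using V by (simp add: minimal_complexity_def factors_def)
    with rank show False
      using minimal_complexity_not_spacer_rank_one by blast
  qed
  ultimately show ?thesis
    unfolding spacer_rank_two_system_def using subshift_subshift_of by blast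
qed

end
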